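(* There is an undetermined game of length $\omega$ whose move set is the set $\mathcal{P}(\mathbb{R})$ of all sets of real numbers and whose payoff set is ordinal definable.
   Context: We work in ZFC. Real numbers are identified with subsets of $\omega$, so $\mathbb{R}=\mathcal{P}(\omega)$. Games: a game is given by an ordinal $\theta$ (its length), a nonempty set $S$ (the move set; one says the game is "on $S$"), and a payoff set $A$ of sequences of moves. It is a perfect information game of two players who move in turns, and at limit ordinals the first player moves (so the first player makes the moves with index $\lambda+2n$ and the second player those with index $\lambda+2n+1$, for $\lambda$ zero or a limit ordinal and $n<\omega$). Each move consists of picking an element of $S$. A position is the sequence of moves made so far at a point before the game ends. The game ends once the sequence of moves has length $\theta$; this sequence is the play. The first player wins if the play belongs to $A$; otherwise the second player wins. A strategy for a player is a mapping that assigns a valid move to every position at which it is that player's turn. A strategy is winning if the player wins whenever he follows it, regardless of the choices of the other player. A game is determined if one of the players has a winning strategy, and undetermined otherwise. A set is ordinal definable if there is an ordinal $\lambda$ such that the set is definable in $V_\lambda$ by a first-order formula with ordinal parameters. *)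

theory Defs
  imports Main
begin

text \<open>
  ``Working in ZFC'' is rendered by quantifying over all models of the first-order theory ZFC:
  the elements of a type form the universe and a binary relation on it interprets membership.
  No well-foundedness or fullness of the model is assumed, and Separation and Replacement are
  schemas over first-order formulas, not over arbitrary HOL predicates. All set-theoretic notions
  below are interpreted inside the model. Every countably infinite model is isomorphic to one
  whose universe is a whole type, so a statement about all such models amounts to provability
  in ZFC.
\<close>

text \<open>First-order formulas of the language of set theory, with de Bruijn indices as variables.\<close>

datatype fm = Mem nat nat | Eq nat nat | Neg fm | Conj fm fm | All fm

text \<open>\<open>sat E D \<phi> e\<close>: the structure with universe \<open>D\<close> and membership \<open>E\<close> satisfies \<open>\<phi>\<close>
  under the assignment \<open>e\<close>. The binder \<open>All\<close> binds variable 0.\<close>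

primrec sat :: "('v \<Rightarrow> 'v \<Rightarrow> bool) \<Rightarrow> 'v set \<Rightarrow> fm \<Rightarrow> (nat \<Rightarrow> 'v) \<Rightarrow> bool" where
  "sat E D (Mem i j) e \<longleftrightarrow> E (e i) (e j)"
| "sat E D (Eq i j) e \<longleftrightarrow> e i = e j"
| "sat E D (Neg \<phi>) e \<longleftrightarrow> \<not> sat E D \<phi> e"
| "sat E D (Conj \<phi> \<psi>) e \<longleftrightarrow> sat E D \<phi> e \<and> sat E D \<psi> e"
| "sat E D (All \<phi>) e \<longleftrightarrow> (\<forall>x\<in>D. sat E D \<phi> (case_nat x e))"

datatype player = First | Second

locale membership =
  fixes E :: "'v \<Rightarrow> 'v \<Rightarrow> bool" (infix "\<epsilon>" 50)
begin

definition is_empty :: "'v \<Rightarrow> bool" where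
  "is_empty x \<longleftrightarrow> (\<forall>z. \<not> z \<epsilon> x)"

definition subset :: "'v \<Rightarrow> 'v \<Rightarrow> bool" where
  "subset x y \<longleftrightarrow> (\<forall>z. z \<epsilon> x \<longrightarrow> z \<epsilon> y)"

definition is_power :: "'v \<Rightarrow> 'v \<Rightarrow> bool" where
  "is_power p x \<longleftrightarrow> (\<forall>z. z \<epsilon> p \<longleftrightarrow> subset z x)"

definition is_succ :: "'v \<Rightarrow> 'v \<Rightarrow> bool" where
  "is_succ s x \<longleftrightarrow> (\<forall>z. z \<epsilon> s \<longleftrightarrow> z \<epsilon> x \<or> z = x)"

definition is_upair :: "'v \<Rightarrow> 'v \<Rightarrow> 'v \<Rightarrow> bool" where
  "is_upair p x y \<longleftrightarrow> (\<forall>z. z \<epsilon> p \<longleftrightarrow> z = x \<or> z = y)"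

definition is_pair :: "'v \<Rightarrow> 'v \<Rightarrow> 'v \<Rightarrow> bool" where
  "is_pair p x y \<longleftrightarrow> (\<forall>z. z \<epsilon> p \<longleftrightarrow> is_upair z x x \<or> is_upair z x y)"

text \<open>\<open>app f x y\<close> says \<open>(x, y) \<in> f\<close>, that is, \<open>f(x) = y\<close> when \<open>f\<close> is a function.\<close>

definition app :: "'v \<Rightarrow> 'v \<Rightarrow> 'v \<Rightarrow> bool" where
  "app f x y \<longleftrightarrow> (\<exists>p. is_pair p x y \<and> p \<epsilon> f)"

definition fun_on :: "'v \<Rightarrow> 'v \<Rightarrow> bool" where
  "fun_on f d \<longleftrightarrow>
     (\<forall>p. p \<epsilon> f \<longrightarrow> (\<exists>x y. x \<epsilon> d \<and> is_pair p x y)) \<and>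
     (\<forall>x. x \<epsilon> d \<longrightarrow> (\<exists>!y. app f x y))"

definition fun_from_to :: "'v \<Rightarrow> 'v \<Rightarrow> 'v \<Rightarrow> bool" where
  "fun_from_to f d S \<longleftrightarrow> fun_on f d \<and> (\<forall>x y. app f x y \<longrightarrow> y \<epsilon> S)"

definition is_restriction :: "'v \<Rightarrow> 'v \<Rightarrow> 'v \<Rightarrow> bool" where
  "is_restriction g f d \<longleftrightarrow> (\<forall>p. p \<epsilon> g \<longleftrightarrow> p \<epsilon> f \<and> (\<exists>x y. x \<epsilon> d \<and> is_pair p x y))"

text \<open>In the presence of Foundation, a set linearly ordered by membership is well-ordered by it.\<close>

definition ordinal :: "'v \<Rightarrow> bool" where
  "ordinal a \<longleftrightarrow>
     (\<forall>x. x \<epsilon> a \<longrightarrow> subset x a) \<and>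
     (\<forall>x y. x \<epsilon> a \<and> y \<epsilon> a \<longrightarrow> x \<epsilon> y \<or> x = y \<or> y \<epsilon> x)"

definition limit_ordinal :: "'v \<Rightarrow> bool" where
  "limit_ordinal a \<longleftrightarrow> ordinal a \<and> \<not> is_empty a \<and> \<not> (\<exists>b. is_succ a b)"

definition is_omega :: "'v \<Rightarrow> bool" where
  "is_omega w \<longleftrightarrow> limit_ordinal w \<and> (\<forall>a. a \<epsilon> w \<longrightarrow> \<not> limit_ordinal a)"

text \<open>\<open>hierarchy f a\<close>: \<open>f\<close> is the sequence of the \<open>V\<^sub>b\<close> for \<open>b \<le> a\<close>.\<close>

definition hierarchy :: "'v \<Rightarrow> 'v \<Rightarrow> bool" where
  "hierarchy f a \<longleftrightarrow> ordinal a \<and> (\<exists>s. is_succ s a \<and> fun_on f s) \<and>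
     (\<forall>b v. app f b v \<longrightarrow>
        (is_empty b \<longrightarrow> is_empty v) \<and>
        (\<forall>c u. is_succ b c \<and> app f c u \<longrightarrow> is_power v u) \<and>
        (limit_ordinal b \<longrightarrow> (\<forall>x. x \<epsilon> v \<longleftrightarrow> (\<exists>c u. c \<epsilon> b \<and> app f c u \<and> x \<epsilon> u))))"

definition is_V :: "'v \<Rightarrow> 'v \<Rightarrow> bool" where
  "is_V v a \<longleftrightarrow> (\<exists>f. hierarchy f a \<and> app f a v)"

text \<open>
  \<open>A\<close> is the unique element of some \<open>V\<^sub>a\<close> satisfying in \<open>(V\<^sub>a, \<in>)\<close> a formula with ordinal
  parameters: variable 0 is the defined object, the other variables are parameters, of which only
  the finitely many occurring in the formula matter. If the model has nonstandard natural numbers,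
  allowing its nonstandard formulas as well would give the same sets: their codes are natural
  numbers of the model and can be passed as ordinal parameters to a satisfaction formula
  evaluated in a larger \<open>V\<^sub>a\<close>.
\<close>

definition ordinal_definable :: "'v \<Rightarrow> bool" where
  "ordinal_definable A \<longleftrightarrow>
     (\<exists>a v \<phi> e. is_V v a \<and> A \<epsilon> v \<and>
        (\<forall>i. ordinal (e i) \<and> e i \<epsilon> v) \<and>
        (\<forall>x. x \<epsilon> v \<longrightarrow> (sat E {z. z \<epsilon> v} \<phi> (case_nat x e) \<longleftrightarrow> x = A)))"

definition is_game :: "'v \<Rightarrow> 'v \<Rightarrow> 'v \<Rightarrow> bool" where
  "is_game \<theta> S A \<longleftrightarrow> ordinal \<theta> \<and> \<not> is_empty S \<and> (\<forall>x. x \<epsilon> A \<longrightarrow> fun_from_to x \<theta> S)"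

text \<open>
  The first player makes the moves with index \<open>\<lambda> + 2n\<close>, \<open>\<lambda>\<close> zero or limit. The set \<open>I\<close> consists
  of these indices up to \<open>a\<close>: zero and limits, having no predecessor, belong to it, and a
  successor belongs to it iff its predecessor does not.
\<close>

definition first_index :: "'v \<Rightarrow> bool" where
  "first_index a \<longleftrightarrow>
     (\<exists>s I. is_succ s a \<and> (\<forall>b. b \<epsilon> s \<longrightarrow> (b \<epsilon> I \<longleftrightarrow> \<not> (\<exists>c. is_succ b c \<and> c \<epsilon> I))) \<and> a \<epsilon> I)"

definition to_move :: "player \<Rightarrow> 'v \<Rightarrow> bool" where
  "to_move P a \<longleftrightarrow> (case P of First \<Rightarrow> first_index a | Second \<Rightarrow> \<not> first_index a)"

definition is_strategy :: "'v \<Rightarrow> 'v \<Rightarrow> player \<Rightarrow> 'v \<Rightarrow> bool" where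
  "is_strategy \<theta> S P \<sigma> \<longleftrightarrow>
     (\<exists>Q. (\<forall>p. p \<epsilon> Q \<longleftrightarrow> (\<exists>a. a \<epsilon> \<theta> \<and> to_move P a \<and> fun_from_to p a S)) \<and> fun_from_to \<sigma> Q S)"

definition follows :: "'v \<Rightarrow> player \<Rightarrow> 'v \<Rightarrow> 'v \<Rightarrow> bool" where
  "follows \<theta> P \<sigma> x \<longleftrightarrow>
     (\<forall>a. a \<epsilon> \<theta> \<and> to_move P a \<longrightarrow>
        (\<exists>p y. is_restriction p x a \<and> app \<sigma> p y \<and> app x a y))"

definition wins :: "'v \<Rightarrow> player \<Rightarrow> 'v \<Rightarrow> bool" where
  "wins A P x \<longleftrightarrow> (case P of First \<Rightarrow> x \<epsilon> A | Second \<Rightarrow> \<not> x \<epsilon> A)"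

definition winning_strategy :: "'v \<Rightarrow> 'v \<Rightarrow> 'v \<Rightarrow> player \<Rightarrow> 'v \<Rightarrow> bool" where
  "winning_strategy \<theta> S A P \<sigma> \<longleftrightarrow> is_strategy \<theta> S P \<sigma> \<and>
     (\<forall>x. fun_from_to x \<theta> S \<and> follows \<theta> P \<sigma> x \<longrightarrow> wins A P x)"

definition determined :: "'v \<Rightarrow> 'v \<Rightarrow> 'v \<Rightarrow> bool" where
  "determined \<theta> S A \<longleftrightarrow> (\<exists>P \<sigma>. winning_strategy \<theta> S A P \<sigma>)"

end

locale zfc = membership +
  assumes extensionality: "(\<forall>z. z \<epsilon> x \<longleftrightarrow> z \<epsilon> y) \<Longrightarrow> x = y"
    and foundation: "\<exists>y. y \<epsilon> x \<Longrightarrow> \<exists>y. y \<epsilon> x \<and> \<not> (\<exists>z. z \<epsilon> x \<and> z \<epsilon> y)"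
    and pairing: "\<exists>p. x \<epsilon> p \<and> y \<epsilon> p"
    and union: "\<exists>u. \<forall>z. (\<exists>y. z \<epsilon> y \<and> y \<epsilon> x) \<longrightarrow> z \<epsilon> u"
    and power: "\<exists>p. \<forall>z. subset z x \<longrightarrow> z \<epsilon> p"
    and infinity: "\<exists>w. (\<exists>z. is_empty z \<and> z \<epsilon> w) \<and> (\<forall>x. x \<epsilon> w \<longrightarrow> (\<exists>s. is_succ s x \<and> s \<epsilon> w))"
    and separation: "\<exists>y. \<forall>x. x \<epsilon> y \<longleftrightarrow> x \<epsilon> a \<and> sat E UNIV \<phi> (case_nat x e)"
    and replacement:
      "(\<forall>x y y'. x \<epsilon> a \<and> sat E UNIV \<phi> (case_nat x (case_nat y e)) \<and>
           sat E UNIV \<phi> (case_nat x (case_nat y' e)) \<longrightarrow> y = y') \<Longrightarrow>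
       \<exists>b. \<forall>y. y \<epsilon> b \<longleftrightarrow> (\<exists>x. x \<epsilon> a \<and> sat E UNIV \<phi> (case_nat x (case_nat y e)))"
    and choice:
      "(\<forall>x. x \<epsilon> a \<longrightarrow> \<not> is_empty x) \<and>
       (\<forall>x y. x \<epsilon> a \<and> y \<epsilon> a \<and> x \<noteq> y \<longrightarrow> \<not> (\<exists>z. z \<epsilon> x \<and> z \<epsilon> y)) \<Longrightarrow>
       \<exists>c. \<forall>x. x \<epsilon> a \<longrightarrow> (\<exists>!z. z \<epsilon> x \<and> z \<epsilon> c)"

end

theory Submission
  imports Defs
begin

text \<open>
  The first player opens with a set \<open>B\<close> of reals. It is required to contain the empty set and to have
  the property that adding one element to a real always changes membership in \<open>B\<close>; such sets exist by
  the axiom of choice (fix a representative of each class of reals modulo finite differences and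
  take the parity of the difference from it). Afterwards the players name natural numbers in strictly
  increasing order, up to the first violation, and the first player wins iff the set of the numbers
  named belongs to \<open>B\<close>.

  Suppose that a player has a winning strategy. At his first move after the opening, the opponent names
  some \<open>v\<close>, and the answer of the strategy is used as the opponent's move in a second play, in which
  \<open>v\<close> is omitted. Copying the answers to and fro in this way makes both plays follow the strategy, while
  the sets of numbers named in them differ by exactly the element \<open>v\<close>. Hence the two plays have different
  winners, which is absurd. A violation affects both plays at the same entry, unless it comes so early
  that \<open>v\<close> has no legal successor; in that case at most two numbers have been named, and since \<open>B\<close>
  contains the empty set, their parity makes the owner of the strategy lose.

  The payoff set is definable in \<open>V\<close> at level \<open>\<omega> + 6\<close> from the parameters 0 and \<open>\<omega>\<close>.
\<close>

subsection \<open>Definability\<close>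

primrec rename :: "(nat \<Rightarrow> nat) \<Rightarrow> fm \<Rightarrow> fm" where
  "rename \<rho> (Mem i j) = Mem (\<rho> i) (\<rho> j)"
| "rename \<rho> (Eq i j) = Eq (\<rho> i) (\<rho> j)"
| "rename \<rho> (Neg \<phi>) = Neg (rename \<rho> \<phi>)"
| "rename \<rho> (Conj \<phi> \<psi>) = Conj (rename \<rho> \<phi>) (rename \<rho> \<psi>)"
| "rename \<rho> (All \<phi>) = All (rename (case_nat 0 (\<lambda>i. Suc (\<rho> i))) \<phi>)"

lemma sat_rename: "sat E D (rename \<rho> \<phi>) e \<longleftrightarrow> sat E D \<phi> (\<lambda>i. e (\<rho> i))"
proof (induction \<phi> arbitrary: \<rho> e)
  case (All \<phi>)
  have "(\<lambda>i. case_nat x e (case_nat 0 (\<lambda>i. Suc (\<rho> i)) i)) = case_nat x (\<lambda>i. e (\<rho> i))" for x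
    by (auto split: nat.split)
  then show ?case
    using All by simp
qed auto

text \<open>Terms are functions of the assignment, so substitution into a formula is composition.
  HOL equality with \<open>\<lambda>e. e 0\<close> tests whether a slot holds the bound
  variable.\<close>

definition is_term :: "'v set \<Rightarrow> ((nat \<Rightarrow> 'v) \<Rightarrow> 'v) \<Rightarrow> bool" where
  "is_term C t \<longleftrightarrow> (\<exists>i. t = (\<lambda>e. e i)) \<or> (\<exists>c\<in>C. t = (\<lambda>e. c))"

text \<open>
  The variables of the formula are instantiated by terms, so that parameters from \<open>C\<close> may occur
  directly in \<open>P\<close>. Conversely \<open>P\<close> may use only the values \<open>e i\<close>, and a binder shifts \<open>e\<close>.
\<close>

definition definable ::
  "('v \<Rightarrow> 'v \<Rightarrow> bool) \<Rightarrow> 'v set \<Rightarrow> 'v set \<Rightarrow> ((nat \<Rightarrow> 'v) \<Rightarrow> bool) \<Rightarrow> bool" where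
  "definable E D C P \<longleftrightarrow> (\<exists>\<phi> u. (\<forall>i. is_term C (u i)) \<and>
     (\<forall>e. (\<forall>i. e i \<in> D) \<longrightarrow> (P e \<longleftrightarrow> sat E D \<phi> (\<lambda>i. u i e))))"

text \<open>Closure of \<open>D\<close> under members makes bounded quantifiers mean the same in
  \<open>D\<close> as in the universe. The two cases of interest are the universe itself and a level
  of the hierarchy with its ordinals as \<open>C\<close>.\<close>

definition transitive_domain :: "('v \<Rightarrow> 'v \<Rightarrow> bool) \<Rightarrow> 'v set \<Rightarrow> 'v set \<Rightarrow> bool" where
  "transitive_domain E D C \<longleftrightarrow> C \<subseteq> D \<and> (\<forall>x y. y \<in> D \<longrightarrow> E x y \<longrightarrow> x \<in> D)"

lemma transitive_domain_UNIV: "transitive_domain E UNIV UNIV"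
  by (simp add: transitive_domain_def)

lemma is_term_var: "is_term C (\<lambda>e. e i)"
  by (auto simp: is_term_def)

lemma is_term_const: "c \<in> C \<Longrightarrow> is_term C (\<lambda>e. c)"
  by (auto simp: is_term_def)

lemma is_term_compose:
  assumes "is_term C t" "\<And>i. is_term C (u i)"
  shows "is_term C (\<lambda>e. t (\<lambda>i. u i e))"
  using assms by (auto simp: is_term_def)

lemma is_term_in_domain:
  "transitive_domain E D C \<Longrightarrow> is_term C t \<Longrightarrow> (\<And>i. e i \<in> D) \<Longrightarrow> t e \<in> D"
  by (auto simp: transitive_domain_def is_term_def)

lemma definable_cong:
  assumes "definable E D C P" "\<And>e. (\<And>i. e i \<in> D) \<Longrightarrow> P e \<longleftrightarrow> Q e"
  shows "definable E D C Q"
proof -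
  obtain \<phi> u where "\<forall>i. is_term C (u i)"
    "\<forall>e. (\<forall>i. e i \<in> D) \<longrightarrow> (P e \<longleftrightarrow> sat E D \<phi> (\<lambda>i. u i e))"
    using assms(1) unfolding definable_def by blast
  then show ?thesis
    unfolding definable_def using assms(2) by (intro exI[of _ \<phi>] exI[of _ u]) simp
qed

lemma definable_mem:
  assumes "is_term C s" "is_term C t"
  shows "definable E D C (\<lambda>e. E (s e) (t e))"
  unfolding definable_def
  by (rule exI[of _ "Mem 0 1"], rule exI[of _ "case_nat s (\<lambda>_. t)"])
     (use assms in \<open>auto split: nat.split\<close>)

lemma definable_eq:
  assumes "is_term C s" "is_term C t"
  shows "definable E D C (\<lambda>e. s e = t e)"
  unfolding definable_def
  by (rule exI[of _ "Eq 0 1"], rule exI[of _ "case_nat s (\<lambda>_. t)"])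
     (use assms in \<open>auto split: nat.split\<close>)

lemma definable_not:
  assumes "definable E D C P"
  shows "definable E D C (\<lambda>e. \<not> P e)"
proof -
  obtain \<phi> u where "\<forall>i. is_term C (u i)"
    "\<forall>e. (\<forall>i. e i \<in> D) \<longrightarrow> (P e \<longleftrightarrow> sat E D \<phi> (\<lambda>i. u i e))"
    using assms unfolding definable_def by blast
  then show ?thesis
    unfolding definable_def by (intro exI[of _ "Neg \<phi>"] exI[of _ u]) simp
qed

lemma definable_conj:
  assumes "definable E D C P" "definable E D C Q"
  shows "definable E D C (\<lambda>e. P e \<and> Q e)"
proof -
  obtain \<phi> u where u: "\<forall>i. is_term C (u i)"
    "\<forall>e. (\<forall>i. e i \<in> D) \<longrightarrow> (P e \<longleftrightarrow> sat E D \<phi> (\<lambda>i. u i e))"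
    using assms unfolding definable_def by blast
  obtain \<psi> w where w: "\<forall>i. is_term C (w i)"
    "\<forall>e. (\<forall>i. e i \<in> D) \<longrightarrow> (Q e \<longleftrightarrow> sat E D \<psi> (\<lambda>i. w i e))"
    using assms unfolding definable_def by blast
  \<comment> \<open>Even slots carry the terms of the first formula and odd slots those of the
    second, so one assignment serves both.\<close>
  let ?v = "\<lambda>i. if even i then u (i div 2) else w (i div 2)"
  show ?thesis
    unfolding definable_def
    by (intro exI[of _ "Conj (rename (\<lambda>i. 2 * i) \<phi>) (rename (\<lambda>i. Suc (2 * i)) \<psi>)"] exI[of _ ?v])
       (use u w in \<open>auto simp: sat_rename\<close>)
qed

lemma definable_Ball:
  assumes "definable E D C (\<lambda>e. P (e 0) (\<lambda>n. e (Suc n)))"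
  shows "definable E D C (\<lambda>e. \<forall>x\<in>D. P x e)"
proof -
  obtain \<phi> u where u: "\<And>i. is_term C (u i)"
    and sat: "\<forall>e. (\<forall>i. e i \<in> D) \<longrightarrow> (P (e 0) (\<lambda>n. e (Suc n)) \<longleftrightarrow> sat E D \<phi> (\<lambda>i. u i e))"
    using assms unfolding definable_def by blast
  \<comment> \<open>All slots holding the bound variable are merged into index 0; the others move up
    by one to make room for it.\<close>
  define \<rho> where "\<rho> i = (if u i = (\<lambda>e. e 0) then 0 else Suc i)" for i
  have "\<exists>t. is_term C t \<and> (u i \<noteq> (\<lambda>e. e 0) \<longrightarrow> (\<forall>x e. u i (case_nat x e) = t e))" for i
    using u[of i] unfolding is_term_def
  proof (elim disjE exE bexE)
    fix k assume "u i = (\<lambda>e. e k)"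
    then show "\<exists>t. ((\<exists>i. t = (\<lambda>e. e i)) \<or> (\<exists>c\<in>C. t = (\<lambda>e. c))) \<and>
        (u i \<noteq> (\<lambda>e. e 0) \<longrightarrow> (\<forall>x e. u i (case_nat x e) = t e))"
      \<comment> \<open>Dropping the bound variable lowers the index by one; for
        \<open>k = 0\<close> the implication is vacuous.\<close>
      by (intro exI[of _ "\<lambda>e. e (k - 1)"]) (auto split: nat.split)
  qed auto
  then obtain w where w: "\<And>i. is_term C (w i)"
    "\<And>i x e. u i \<noteq> (\<lambda>e. e 0) \<Longrightarrow> u i (case_nat x e) = w i e"
    by metis
  have eq: "(\<lambda>i. case_nat x (\<lambda>i. w i e) (\<rho> i)) = (\<lambda>i. u i (case_nat x e))" for x e
    by (auto simp: \<rho>_def w(2))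
  have P: "P x e \<longleftrightarrow> sat E D \<phi> (\<lambda>i. u i (case_nat x e))"
    if "\<forall>i. e i \<in> D" "x \<in> D" for x e
    using sat[rule_format, of "case_nat x e"] that by (auto split: nat.split)
  have "(\<forall>x\<in>D. P x e) \<longleftrightarrow> sat E D (All (rename \<rho> \<phi>)) (\<lambda>i. w i e)"
    if "\<forall>i. e i \<in> D" for e
    unfolding sat.simps sat_rename eq using P[OF that] by blast
  then show ?thesis
    unfolding definable_def using w(1) by blast
qed

lemma definable_subst:
  assumes "definable E D C P" "\<And>i. is_term C (t i)" "transitive_domain E D C"
  shows "definable E D C (\<lambda>e. P (\<lambda>i. t i e))"
proof -
  obtain \<phi> u where u: "\<And>i. is_term C (u i)"
    and sat: "\<forall>e. (\<forall>i. e i \<in> D) \<longrightarrow> (P e \<longleftrightarrow> sat E D \<phi> (\<lambda>i. u i e))"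
    using assms unfolding definable_def by blast
  have "is_term C (\<lambda>e. u i (\<lambda>j. t j e))" for i
    using u assms(2) by (rule is_term_compose)
  moreover have "P (\<lambda>i. t i e) \<longleftrightarrow> sat E D \<phi> (\<lambda>i. u i (\<lambda>j. t j e))" if "\<forall>i. e i \<in> D" for e
  proof -
    have "\<forall>i. t i e \<in> D"
      using is_term_in_domain[OF assms(3,2)] that by simp
    then show ?thesis
      using sat by simp
  qed
  ultimately show ?thesis
    unfolding definable_def by (intro exI[of _ \<phi>] exI[of _ "\<lambda>i e. u i (\<lambda>j. t j e)"]) blast
qed

lemma definable_imp:
  "definable E D C P \<Longrightarrow> definable E D C Q \<Longrightarrow> definable E D C (\<lambda>e. P e \<longrightarrow> Q e)"
  by (rule definable_cong[OF definable_not[OF definable_conj[OF _ definable_not]]]) auto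

lemma definable_disj:
  "definable E D C P \<Longrightarrow> definable E D C Q \<Longrightarrow> definable E D C (\<lambda>e. P e \<or> Q e)"
  by (rule definable_cong[OF definable_imp[OF definable_not[of E D C P], of Q]]) auto

lemma definable_iff:
  "definable E D C P \<Longrightarrow> definable E D C Q \<Longrightarrow> definable E D C (\<lambda>e. P e \<longleftrightarrow> Q e)"
  by (rule definable_cong[OF definable_conj[OF definable_imp[of E D C P Q] definable_imp[of E D C Q P]]])
     auto

lemma definable_Bex:
  assumes "definable E D C (\<lambda>e. P (e 0) (\<lambda>n. e (Suc n)))"
  shows "definable E D C (\<lambda>e. \<exists>x\<in>D. P x e)"
  by (rule definable_cong[OF definable_not[OF definable_Ball[where P = "\<lambda>x e. \<not> P x e"]]])
     (rule definable_not[OF assms], simp)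

lemma definable_all:
  assumes "definable E UNIV C (\<lambda>e. P (e 0) (\<lambda>n. e (Suc n)))"
  shows "definable E UNIV C (\<lambda>e. \<forall>x. P x e)"
  using definable_Ball[OF assms] by simp

lemma definable_ex:
  assumes "definable E UNIV C (\<lambda>e. P (e 0) (\<lambda>n. e (Suc n)))"
  shows "definable E UNIV C (\<lambda>e. \<exists>x. P x e)"
  using definable_Bex[OF assms] by simp

lemma is_term_shift: "is_term C t \<Longrightarrow> is_term C (\<lambda>e. t (\<lambda>n. e (Suc n)))"
  by (rule is_term_compose[where u = "\<lambda>i e. e (Suc i)"]) (auto intro: is_term_var)

text \<open>Members of \<open>t e\<close> lie in \<open>D\<close>, so the HOL quantifier over the
  whole type agrees with the formula's quantifier over \<open>D\<close>.\<close>

lemma definable_all_mem: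
  assumes "transitive_domain E D C" "is_term C t"
    and "definable E D C (\<lambda>e. P (e 0) (\<lambda>n. e (Suc n)))"
  shows "definable E D C (\<lambda>e. \<forall>x. E x (t e) \<longrightarrow> P x e)"
proof (rule definable_cong)
  show "definable E D C (\<lambda>e. \<forall>x\<in>D. E x (t e) \<longrightarrow> P x e)"
    by (rule definable_Ball) (intro definable_imp definable_mem is_term_var
        is_term_shift[OF assms(2)] assms(3))
  show "(\<forall>x\<in>D. E x (t e) \<longrightarrow> P x e) \<longleftrightarrow> (\<forall>x. E x (t e) \<longrightarrow> P x e)" if "\<And>i. e i \<in> D" for e
  proof -
    have "t e \<in> D"
      by (rule is_term_in_domain[OF assms(1,2) that])
    then have "x \<in> D" if "E x (t e)" for x
      using assms(1) that unfolding transitive_domain_def by simp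
    then show ?thesis
      by blast
  qed
qed

lemma definable_ex_mem:
  assumes "transitive_domain E D C" "is_term C t"
    and "definable E D C (\<lambda>e. P (e 0) (\<lambda>n. e (Suc n)))"
  shows "definable E D C (\<lambda>e. \<exists>x. E x (t e) \<and> P x e)"
  by (rule definable_cong[OF definable_not[OF definable_all_mem[OF assms(1,2),
        where P = "\<lambda>x e. \<not> P x e"]]])
     (rule definable_not[OF assms(3)], simp)

text \<open>With this and its analogues a notion is unfolded and proved definable once, at plain
  variables, and then used at arbitrary terms.\<close>

lemma definable_subst1:
  assumes "transitive_domain E D C" "definable E D C (\<lambda>e. P (e 0))" "is_term C s"
  shows "definable E D C (\<lambda>e. P (s e))"
  using definable_subst[OF assms(2), of "\<lambda>i. s"] assms by simp

lemma definable_subst2: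
  assumes "transitive_domain E D C" "definable E D C (\<lambda>e. P (e 0) (e 1))"
    and "is_term C s" "is_term C t"
  shows "definable E D C (\<lambda>e. P (s e) (t e))"
  using definable_subst[OF assms(2), of "case_nat s (\<lambda>i. t)"] assms by (simp split: nat.split)

lemma definable_subst3:
  assumes "transitive_domain E D C" "definable E D C (\<lambda>e. P (e 0) (e 1) (e 2))"
    and "is_term C s" "is_term C t" "is_term C u"
  shows "definable E D C (\<lambda>e. P (s e) (t e) (u e))"
  using definable_subst[OF assms(2), of "case_nat s (case_nat t (\<lambda>i. u))"] assms
  by (simp split: nat.split add: numeral_2_eq_2)

text \<open>The shape required by the axiom schemas: two genuine variables, with every constant and
  every further variable turned into a parameter.\<close>

lemma definable_parameters:
  assumes "definable E UNIV UNIV P"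
  shows "\<exists>\<phi> e'. \<forall>x y. P (case_nat x (case_nat y e)) \<longleftrightarrow> sat E UNIV \<phi> (case_nat x (case_nat y e'))"
proof -
  obtain \<phi> u where u: "\<And>i. is_term UNIV (u i)"
    and sat: "\<And>e. P e \<longleftrightarrow> sat E UNIV \<phi> (\<lambda>i. u i e)"
    using assms unfolding definable_def by auto
  define \<rho> where "\<rho> i = (if u i = (\<lambda>e. e 0) then 0 else if u i = (\<lambda>e. e 1) then 1 else i + 2)" for i
  \<comment> \<open>A slot reading variable \<open>k \<ge> 2\<close> becomes the parameter
    \<open>e (k - 2)\<close>; a constant stays itself.\<close>
  define w where "w i = u i (\<lambda>n. e (n - 2))" for i
  have "u i (case_nat x (case_nat y e)) = w i" if "u i \<noteq> (\<lambda>e. e 0)" "u i \<noteq> (\<lambda>e. e 1)" for i x y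
    using u[of i] that unfolding is_term_def w_def by (auto split: nat.split)
  then have "(\<lambda>i. u i (case_nat x (case_nat y e))) = (\<lambda>i. case_nat x (case_nat y w) (\<rho> i))" for x y
    by (auto simp: \<rho>_def)
  then show ?thesis
    using sat by (intro exI[of _ "rename \<rho> \<phi>"] exI[of _ w]) (simp add: sat_rename)
qed

lemmas definable_intros =
  is_term_var is_term_const UNIV_I transitive_domain_UNIV
  definable_mem definable_eq definable_not definable_conj definable_disj definable_imp
  definable_iff definable_all_mem definable_ex_mem definable_Ball definable_Bex
  definable_all definable_ex

text \<open>Lets the HOL truth value in \<open>tail_rel\<close> occur inside a definable
  predicate.\<close>

lemma definable_const: "definable E D C (\<lambda>e. b)"
proof -
  have "definable E D C (\<lambda>e. e 0 = e 0)" "definable E D C (\<lambda>e. \<not> e 0 = e 0)"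
    by (intro definable_intros)+
  then show ?thesis
    by (cases b) simp_all
qed

text \<open>The shape required by \<open>ordinal_definable\<close>: one free variable and all
  parameters in \<open>C\<close>. Slots reading other variables are filled with
  \<open>c\<close>.\<close>

lemma definable_single:
  assumes "definable E D C (\<lambda>e. P (e 0))" "c \<in> C" "C \<subseteq> D"
  shows "\<exists>\<phi> e. (\<forall>i. e i \<in> C) \<and> (\<forall>x\<in>D. P x \<longleftrightarrow> sat E D \<phi> (case_nat x e))"
proof -
  obtain \<phi> u where u: "\<And>i. is_term C (u i)"
    and sat: "\<And>e. (\<forall>i. e i \<in> D) \<Longrightarrow> P (e 0) \<longleftrightarrow> sat E D \<phi> (\<lambda>i. u i e)"
    using assms(1) unfolding definable_def by auto
  define \<rho> where "\<rho> i = (if u i = (\<lambda>e. e 0) then 0 else Suc i)" for i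
  define w where "w i = u i (\<lambda>_. c)" for i
  have "u i (case_nat x (\<lambda>_. c)) = w i" if "u i \<noteq> (\<lambda>e. e 0)" for i x
    using u[of i] that unfolding is_term_def w_def by (auto split: nat.split)
  then have eq: "(\<lambda>i. u i (case_nat x (\<lambda>_. c))) = (\<lambda>i. case_nat x w (\<rho> i))" for x
    by (auto simp: \<rho>_def)
  have "P x \<longleftrightarrow> sat E D (rename \<rho> \<phi>) (case_nat x w)" if "x \<in> D" for x
  proof -
    have "P x \<longleftrightarrow> sat E D \<phi> (\<lambda>i. u i (case_nat x (\<lambda>_. c)))"
      using sat[of "case_nat x (\<lambda>_. c)"] that assms(2,3) by (auto split: nat.split)
    then show ?thesis
      unfolding sat_rename eq .
  qed
  moreover have "w i \<in> C" for i
    using u[of i] assms(2) by (auto simp: w_def is_term_def)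
  ultimately show ?thesis
    by blast
qed

context zfc
begin

abbreviation class_definable :: "((nat \<Rightarrow> 'a) \<Rightarrow> bool) \<Rightarrow> bool" where
  "class_definable \<equiv> definable E UNIV UNIV"

lemma definable_separation:
  assumes "class_definable (\<lambda>e. P (e 0))"
  shows "\<exists>y. \<forall>x. x \<epsilon> y \<longleftrightarrow> x \<epsilon> a \<and> P x"
proof -
  obtain \<phi> e' where "\<And>x y. P x \<longleftrightarrow> sat E UNIV \<phi> (case_nat x (case_nat y e'))"
    using definable_parameters[OF assms, of "\<lambda>_. a"] by auto
  then show ?thesis
    using separation[of a \<phi> "case_nat a e'"] by simp
qed

lemma definable_replacement:
  assumes "class_definable (\<lambda>e. F (e 0) (e 1))"
    and "\<And>x y y'. x \<epsilon> a \<Longrightarrow> F x y \<Longrightarrow> F x y' \<Longrightarrow> y = y'"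
  shows "\<exists>b. \<forall>y. y \<epsilon> b \<longleftrightarrow> (\<exists>x. x \<epsilon> a \<and> F x y)"
proof -
  obtain \<phi> e' where F: "\<And>x y. F x y \<longleftrightarrow> sat E UNIV \<phi> (case_nat x (case_nat y e'))"
    using definable_parameters[OF assms(1), of "\<lambda>_. a"] by auto
  show ?thesis
    using replacement[of a \<phi> e'] assms(2) unfolding F[symmetric] by blast
qed

subsection \<open>Elementary set theory\<close>

definition is_set :: "('a \<Rightarrow> bool) \<Rightarrow> bool" where
  "is_set P \<longleftrightarrow> (\<exists>s. \<forall>z. z \<epsilon> s \<longleftrightarrow> P z)"

text \<open>A definite description, informative only once \<open>is_set P\<close> is known;
  \<open>mem_zero\<close>, \<open>mem_upair\<close> and their analogues establish this once per
  operation.\<close>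

definition collect :: "('a \<Rightarrow> bool) \<Rightarrow> 'a" where
  "collect P = (THE s. \<forall>z. z \<epsilon> s \<longleftrightarrow> P z)"

lemma mem_collect:
  assumes "is_set P"
  shows "z \<epsilon> collect P \<longleftrightarrow> P z"
proof -
  have "\<exists>!s. \<forall>z. z \<epsilon> s \<longleftrightarrow> P z"
    using assms extensionality unfolding is_set_def by (metis (full_types))
  then have "\<forall>z. z \<epsilon> collect P \<longleftrightarrow> P z"
    unfolding collect_def by (rule theI')
  then show ?thesis
    by blast
qed

lemma is_set_bounded:
  assumes "class_definable (\<lambda>e. P (e 0))" "\<And>z. P z \<Longrightarrow> z \<epsilon> a"
  shows "is_set P"
  using definable_separation[OF assms(1), of a] assms(2) unfolding is_set_def by blast

lemma is_set_sep:
  assumes "class_definable (\<lambda>e. P (e 0))"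
  shows "is_set (\<lambda>z. z \<epsilon> a \<and> P z)"
  using definable_separation[OF assms] unfolding is_set_def by blast

definition zero :: 'a where "zero = collect (\<lambda>_. False)"
definition upair :: "'a \<Rightarrow> 'a \<Rightarrow> 'a" where "upair x y = collect (\<lambda>z. z = x \<or> z = y)"
definition pair :: "'a \<Rightarrow> 'a \<Rightarrow> 'a" where "pair x y = upair (upair x x) (upair x y)"
definition bigunion :: "'a \<Rightarrow> 'a" where "bigunion x = collect (\<lambda>z. \<exists>y. z \<epsilon> y \<and> y \<epsilon> x)"
definition join :: "'a \<Rightarrow> 'a \<Rightarrow> 'a" where "join x y = bigunion (upair x y)"
definition pow :: "'a \<Rightarrow> 'a" where "pow x = collect (\<lambda>z. subset z x)"
definition suc :: "'a \<Rightarrow> 'a" where "suc x = join x (upair x x)"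

lemma mem_zero [simp]: "\<not> z \<epsilon> zero"
proof -
  have "is_set (\<lambda>_. False)"
    by (rule is_set_bounded[where a = undefined])
      (auto intro: definable_cong[OF definable_not[OF definable_eq]] is_term_var)
  then show ?thesis
    unfolding zero_def by (simp add: mem_collect)
qed

lemma mem_upair [simp]: "z \<epsilon> upair x y \<longleftrightarrow> z = x \<or> z = y"
proof -
  obtain p where "x \<epsilon> p" "y \<epsilon> p"
    using pairing by blast
  then have "is_set (\<lambda>z. z = x \<or> z = y)"
    by (intro is_set_bounded[where a = p]) (auto intro!: definable_intros)
  then show ?thesis
    unfolding upair_def by (simp add: mem_collect)
qed

lemma mem_bigunion [simp]: "z \<epsilon> bigunion x \<longleftrightarrow> (\<exists>y. z \<epsilon> y \<and> y \<epsilon> x)"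
proof -
  obtain u where "\<forall>z. (\<exists>y. z \<epsilon> y \<and> y \<epsilon> x) \<longrightarrow> z \<epsilon> u"
    using union by blast
  then have "is_set (\<lambda>z. \<exists>y. z \<epsilon> y \<and> y \<epsilon> x)"
    by (intro is_set_bounded[where a = u]) (intro definable_intros, blast)
  then show ?thesis
    unfolding bigunion_def by (simp add: mem_collect)
qed

lemma mem_join [simp]: "z \<epsilon> join x y \<longleftrightarrow> z \<epsilon> x \<or> z \<epsilon> y"
  by (auto simp: join_def)

lemma mem_pow [simp]: "z \<epsilon> pow x \<longleftrightarrow> subset z x"
proof -
  obtain p where "\<forall>z. subset z x \<longrightarrow> z \<epsilon> p"
    using power by blast
  then have "is_set (\<lambda>z. subset z x)"
    unfolding subset_def by (intro is_set_bounded[where a = p]) (intro definable_intros, blast)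
  then show ?thesis
    unfolding pow_def by (simp add: mem_collect)
qed

lemma mem_suc [simp]: "z \<epsilon> suc x \<longleftrightarrow> z \<epsilon> x \<or> z = x"
  by (auto simp: suc_def)

text \<open>These rules turn relational notions into functions for the simplifier. The relational
  form has to stay wherever definability is to be shown, since formulas have no function
  symbols.\<close>

lemma is_empty_iff [simp]: "is_empty x \<longleftrightarrow> x = zero"
  using extensionality[of x zero] by (auto simp: is_empty_def)

lemma is_power_iff [simp]: "is_power p x \<longleftrightarrow> p = pow x"
  using extensionality[of p "pow x"] by (auto simp: is_power_def)

lemma is_succ_iff [simp]: "is_succ s x \<longleftrightarrow> s = suc x"
  using extensionality[of s "suc x"] by (auto simp: is_succ_def)

lemma is_upair_iff [simp]: "is_upair p x y \<longleftrightarrow> p = upair x y"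
  using extensionality[of p "upair x y"] by (auto simp: is_upair_def)

lemma is_pair_iff [simp]: "is_pair p x y \<longleftrightarrow> p = pair x y"
  using extensionality[of p "pair x y"] by (auto simp: is_pair_def pair_def)

lemma app_iff: "app f x y \<longleftrightarrow> pair x y \<epsilon> f"
  by (simp add: app_def)

lemma upair_eq_iff: "upair x y = upair a b \<longleftrightarrow> x = a \<and> y = b \<or> x = b \<and> y = a"
proof
  assume "upair x y = upair a b"
  then have "z = x \<or> z = y \<longleftrightarrow> z = a \<or> z = b" for z
    by (metis mem_upair)
  then show "x = a \<and> y = b \<or> x = b \<and> y = a"
    by metis
next
  assume "x = a \<and> y = b \<or> x = b \<and> y = a"
  then show "upair x y = upair a b"
    by (auto intro!: extensionality)
qed

lemma pair_eq_iff [simp]: "pair x y = pair a b \<longleftrightarrow> x = a \<and> y = b"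
  unfolding pair_def upair_eq_iff by auto

lemma not_mem_self [simp]: "\<not> x \<epsilon> x"
  using foundation[of "upair x x"] by auto

lemma not_mem_cycle: "x \<epsilon> y \<Longrightarrow> \<not> y \<epsilon> x"
  using foundation[of "upair x y"] by auto

lemma suc_eq_iff [simp]: "suc x = suc y \<longleftrightarrow> x = y"
  by (metis mem_suc not_mem_cycle)

lemma suc_not_zero [simp]: "suc x \<noteq> zero" "zero \<noteq> suc x"
  by (metis mem_suc mem_zero)+

section \<open>Bounded formulas for the basic notions\<close>

context
  fixes D C :: "'a set"
  assumes dom: "transitive_domain E D C"
begin

lemma definable_subset:
  assumes "is_term C s" "is_term C t"
  shows "definable E D C (\<lambda>e. subset (s e) (t e))"
  by (rule definable_subst2[OF dom _ assms]) (unfold subset_def, intro definable_intros dom)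

lemma definable_is_empty:
  assumes "is_term C s"
  shows "definable E D C (\<lambda>e. is_empty (s e))"
proof (rule definable_subst1[OF dom _ assms])
  have "definable E D C (\<lambda>e. \<forall>z. z \<epsilon> e 0 \<longrightarrow> \<not> z = z)"
    by (intro definable_intros dom)
  then show "definable E D C (\<lambda>e. is_empty (e 0))"
    by (rule definable_cong) (simp only: is_empty_def simp_thms)
qed

text \<open>The unbounded quantifier of \<open>is_succ\<close> is traded for bounded inclusions, so
  that the formula is correct in every transitive domain. The next lemmas proceed in the same
  way.\<close>

lemma definable_is_succ:
  assumes "is_term C s" "is_term C t"
  shows "definable E D C (\<lambda>e. is_succ (s e) (t e))"
proof (rule definable_subst2[OF dom _ assms])
  have "definable E D C (\<lambda>e. (\<forall>z. z \<epsilon> e 0 \<longrightarrow> z \<epsilon> e 1 \<or> z = e 1) \<and> (\<forall>z. z \<epsilon> e 1 \<longrightarrow> z \<epsilon> e 0) \<and> e 1 \<epsilon> e 0)"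
    by (intro definable_intros dom)
  then show "definable E D C (\<lambda>e. is_succ (e 0) (e 1))"
    by (rule definable_cong) (unfold is_succ_def, blast)
qed

lemma definable_is_upair:
  assumes "is_term C s" "is_term C t" "is_term C u"
  shows "definable E D C (\<lambda>e. is_upair (s e) (t e) (u e))"
proof (rule definable_subst3[OF dom _ assms])
  have "definable E D C (\<lambda>e. (\<forall>z. z \<epsilon> e 0 \<longrightarrow> z = e 1 \<or> z = e 2) \<and> e 1 \<epsilon> e 0 \<and> e 2 \<epsilon> e 0)"
    by (intro definable_intros dom)
  then show "definable E D C (\<lambda>e. is_upair (e 0) (e 1) (e 2))"
    by (rule definable_cong) (unfold is_upair_def, blast)
qed

lemma definable_is_pair:
  assumes "is_term C s" "is_term C t" "is_term C u"
  shows "definable E D C (\<lambda>e. is_pair (s e) (t e) (u e))"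
proof (rule definable_subst3[OF dom _ assms])
  have "definable E D C (\<lambda>e. (\<forall>z. z \<epsilon> e 0 \<longrightarrow> is_upair z (e 1) (e 1) \<or> is_upair z (e 1) (e 2)) \<and>
      (\<exists>z. z \<epsilon> e 0 \<and> is_upair z (e 1) (e 1)) \<and> (\<exists>z. z \<epsilon> e 0 \<and> is_upair z (e 1) (e 2)))"
    by (intro definable_intros definable_is_upair dom)
  then show "definable E D C (\<lambda>e. is_pair (e 0) (e 1) (e 2))"
    by (rule definable_cong) (auto simp: is_pair_def simp del: is_pair_iff)
qed

lemma definable_app:
  assumes "is_term C s" "is_term C t" "is_term C u"
  shows "definable E D C (\<lambda>e. app (s e) (t e) (u e))"
proof (rule definable_subst3[OF dom _ assms])
  have "definable E D C (\<lambda>e. \<exists>p. p \<epsilon> e 0 \<and> is_pair p (e 1) (e 2))"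
    by (intro definable_intros definable_is_pair dom)
  then show "definable E D C (\<lambda>e. app (e 0) (e 1) (e 2))"
    by (rule definable_cong) (unfold app_def, blast)
qed

lemma definable_fun_on:
  assumes "is_term C s" "is_term C t"
  shows "definable E D C (\<lambda>e. fun_on (s e) (t e))"
proof (rule definable_subst2[OF dom _ assms])
  \<comment> \<open>Quantifiers over second components can thus be bounded by members of members of
    the pair.\<close>
  have mem: "\<exists>z. z \<epsilon> pair x y \<and> y \<epsilon> z" for x y
    by (auto simp: pair_def)
  have *: "definable E D C (\<lambda>e. (\<forall>p. p \<epsilon> e 0 \<longrightarrow> (\<exists>x. x \<epsilon> e 1 \<and> (\<exists>z. z \<epsilon> p \<and> (\<exists>y. y \<epsilon> z \<and> is_pair p x y)))) \<and>
     (\<forall>x. x \<epsilon> e 1 \<longrightarrow>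
       (\<exists>p. p \<epsilon> e 0 \<and> (\<exists>z. z \<epsilon> p \<and> (\<exists>y. y \<epsilon> z \<and> is_pair p x y))) \<and>
       (\<forall>p. p \<epsilon> e 0 \<longrightarrow> (\<forall>z. z \<epsilon> p \<longrightarrow> (\<forall>y. y \<epsilon> z \<longrightarrow>
       (\<forall>p'. p' \<epsilon> e 0 \<longrightarrow> (\<forall>z'. z' \<epsilon> p' \<longrightarrow> (\<forall>y'. y' \<epsilon> z' \<longrightarrow>
         is_pair p x y \<and> is_pair p' x y' \<longrightarrow> y = y'))))))))"
    by (intro definable_intros definable_is_pair dom)
  have eq1: "(\<exists>z. z \<epsilon> p \<and> (\<exists>y. y \<epsilon> z \<and> is_pair p x y)) \<longleftrightarrow> (\<exists>y. is_pair p x y)" for p x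
    using mem by auto
  have eq2: "(\<forall>p. p \<epsilon> f \<longrightarrow> (\<forall>z. z \<epsilon> p \<longrightarrow> (\<forall>y. y \<epsilon> z \<longrightarrow>
       (\<forall>p'. p' \<epsilon> f \<longrightarrow> (\<forall>z'. z' \<epsilon> p' \<longrightarrow> (\<forall>y'. y' \<epsilon> z' \<longrightarrow>
         is_pair p x y \<and> is_pair p' x y' \<longrightarrow> y = y')))))) \<longleftrightarrow>
       (\<forall>y y'. app f x y \<and> app f x y' \<longrightarrow> y = y')" (is "?L \<longleftrightarrow> ?R") for f x
  proof
    assume ?L
    then show ?R
      unfolding app_iff is_pair_iff by (metis mem)
  next
    assume R: ?R
    show ?L
      unfolding is_pair_iff
    proof (intro allI impI, elim conjE)
      fix p z y p' z' y'
      assume "p \<epsilon> f" "p' \<epsilon> f" "p = pair x y" "p' = pair x y'"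
      then show "y = y'"
        using R unfolding app_iff by simp
    qed
  qed
  have eq3: "(\<exists>p. p \<epsilon> f \<and> (\<exists>y. is_pair p x y)) \<longleftrightarrow> (\<exists>y. app f x y)" for f x
    unfolding app_def by blast
  show "definable E D C (\<lambda>e. fun_on (e 0) (e 1))"
    by (rule definable_cong[OF *]) (simp only: eq1 eq2 eq3 fun_on_def Ex1_def, blast)
qed

end

lemmas definable_set_intros =
  definable_intros definable_subset definable_is_empty definable_is_succ definable_is_upair
  definable_is_pair definable_app definable_fun_on

text \<open>Unbounded quantifiers remain here, hence the confinement to the universe.\<close>

lemma definable_is_restriction:
  assumes "is_term UNIV s" "is_term UNIV t" "is_term UNIV u"
  shows "class_definable (\<lambda>e. is_restriction (s e) (t e) (u e))"
  by (rule definable_subst3[OF transitive_domain_UNIV _ assms])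
     (unfold is_restriction_def, intro definable_set_intros)

lemma definable_is_power:
  assumes "is_term UNIV s" "is_term UNIV t"
  shows "class_definable (\<lambda>e. is_power (s e) (t e))"
  by (rule definable_subst2[OF transitive_domain_UNIV _ assms])
     (unfold is_power_def, intro definable_set_intros)

lemmas definable_class_intros = definable_set_intros definable_is_restriction definable_is_power

subsection \<open>Natural numbers, functions and recursion\<close>

definition is_inductive :: "'a \<Rightarrow> bool" where
  "is_inductive I \<longleftrightarrow> (\<exists>z. is_empty z \<and> z \<epsilon> I) \<and> (\<forall>x. x \<epsilon> I \<longrightarrow> (\<exists>s. is_succ s x \<and> s \<epsilon> I))"

definition omega :: 'a where "omega = collect (\<lambda>n. \<forall>I. is_inductive I \<longrightarrow> n \<epsilon> I)"

lemma mem_omega: "n \<epsilon> omega \<longleftrightarrow> (\<forall>I. is_inductive I \<longrightarrow> n \<epsilon> I)"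
proof -
  obtain w where "is_inductive w"
    using infinity unfolding is_inductive_def by blast
  then have "is_set (\<lambda>n. \<forall>I. is_inductive I \<longrightarrow> n \<epsilon> I)"
    unfolding is_inductive_def
    by (intro is_set_bounded[where a = w]) (intro definable_class_intros, blast)
  then show ?thesis
    unfolding omega_def by (simp add: mem_collect)
qed

lemma zero_mem_omega [simp]: "zero \<epsilon> omega"
  by (simp add: mem_omega is_inductive_def)

lemma suc_mem_omega [simp]: "n \<epsilon> omega \<Longrightarrow> suc n \<epsilon> omega"
  by (simp add: mem_omega is_inductive_def)

text \<open>The model may have nonstandard numbers, so induction is available only for definable
  \<open>P\<close>, by Separation. Hence the \<open>definable\<close> case in each use, and
  induction statements that prefer \<open>app\<close> and \<open>is_succ\<close> to
  \<open>val\<close> and \<open>suc\<close> at bound variables.\<close>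

lemma omega_induct [consumes 1, case_names definable zero suc]:
  assumes "n \<epsilon> omega" "class_definable (\<lambda>e. P (e 0))"
    and "P zero" "\<And>n. n \<epsilon> omega \<Longrightarrow> P n \<Longrightarrow> P (suc n)"
  shows "P n"
proof -
  obtain I where "\<And>x. x \<epsilon> I \<longleftrightarrow> x \<epsilon> omega \<and> P x"
    using definable_separation[OF assms(2)] by blast
  moreover from this have "is_inductive I"
    using assms(3,4) by (simp add: is_inductive_def)
  ultimately show ?thesis
    using assms(1) mem_omega by blast
qed

lemma omega_cases:
  assumes "n \<epsilon> omega"
  obtains "n = zero" | m where "m \<epsilon> omega" "n = suc m"
proof -
  from assms have "is_empty n \<or> (\<exists>m. m \<epsilon> omega \<and> is_succ n m)"
  proof (induction n rule: omega_induct)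
    case definable
    show ?case by (intro definable_class_intros)
  qed auto
  then show ?thesis
    using that by auto
qed

lemma omega_transitive:
  assumes "n \<epsilon> omega" "m \<epsilon> n"
  shows "m \<epsilon> omega"
proof -
  from assms(1) have "\<forall>m. m \<epsilon> n \<longrightarrow> m \<epsilon> omega"
  proof (induction n rule: omega_induct)
    case definable
    show ?case by (intro definable_class_intros)
  qed auto
  then show ?thesis
    using assms(2) by blast
qed

lemma nat_transitive:
  assumes "n \<epsilon> omega" "m \<epsilon> n" "l \<epsilon> m"
  shows "l \<epsilon> n"
proof -
  from assms(1) have "\<forall>m. m \<epsilon> n \<longrightarrow> subset m n"
  proof (induction n rule: omega_induct)
    case definable
    show ?case by (intro definable_class_intros)
  qed (auto simp: subset_def)
  then show ?thesis
    using assms(2,3) by (auto simp: subset_def)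
qed

lemma zero_mem_nat:
  assumes "n \<epsilon> omega"
  shows "n = zero \<or> zero \<epsilon> n"
  using assms
proof (induction n rule: omega_induct)
  case definable
  show ?case by (intro definable_class_intros)
qed auto

lemma suc_mem_suc [simp]:
  assumes "n \<epsilon> omega"
  shows "suc m \<epsilon> suc n \<longleftrightarrow> m \<epsilon> n"
proof
  assume "suc m \<epsilon> suc n"
  then show "m \<epsilon> n"
    using nat_transitive[OF assms, of "suc m" m] by (auto simp del: suc_eq_iff)
next
  from assms have *: "\<forall>m. m \<epsilon> n \<longrightarrow> (\<forall>s. is_succ s m \<longrightarrow> s \<epsilon> n \<or> s = n)"
  proof (induction n rule: omega_induct)
    case definable
    show ?case by (intro definable_class_intros)
  qed auto
  show "suc m \<epsilon> suc n" if "m \<epsilon> n"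
    using * that by auto
qed

lemma nat_linear:
  assumes "m \<epsilon> omega" "n \<epsilon> omega"
  shows "m \<epsilon> n \<or> m = n \<or> n \<epsilon> m"
  using assms(1)
proof (induction m rule: omega_induct)
  case definable
  show ?case by (intro definable_class_intros)
next
  case zero
  show ?case using zero_mem_nat[OF assms(2)] by auto
next
  case (suc m)
  then show ?case
    using suc_mem_suc[OF assms(2), of m] by auto
qed

lemma ordinal_nat: "n \<epsilon> omega \<Longrightarrow> ordinal n"
  unfolding ordinal_def subset_def
  using nat_transitive nat_linear omega_transitive by blast

lemma ordinal_omega: "ordinal omega"
  unfolding ordinal_def subset_def using nat_linear omega_transitive by blast

lemma omega_not_zero [simp]: "omega \<noteq> zero"
  using zero_mem_omega mem_zero by metis

lemma omega_not_suc [simp]: "omega \<noteq> suc b" "suc b \<noteq> omega"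
  using suc_mem_omega[of b] mem_suc[of b b] not_mem_self by metis+

lemma is_omega_omega: "is_omega omega"
  unfolding is_omega_def limit_ordinal_def
  by (auto simp: ordinal_omega elim: omega_cases)

lemma not_limit_nat: "n \<epsilon> omega \<Longrightarrow> \<not> limit_ordinal n"
  using is_omega_omega unfolding is_omega_def by blast

section \<open>Functions as sets of pairs\<close>

definition res :: "'a \<Rightarrow> 'a \<Rightarrow> 'a" where
  "res f d = collect (\<lambda>p. p \<epsilon> f \<and> (\<exists>x y. x \<epsilon> d \<and> is_pair p x y))"

definition val :: "'a \<Rightarrow> 'a \<Rightarrow> 'a" where
  "val f x = (THE y. app f x y)"

lemma mem_res: "p \<epsilon> res f d \<longleftrightarrow> p \<epsilon> f \<and> (\<exists>x y. x \<epsilon> d \<and> p = pair x y)"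
proof -
  have "is_set (\<lambda>p. p \<epsilon> f \<and> (\<exists>x y. x \<epsilon> d \<and> is_pair p x y))"
    by (intro is_set_sep definable_class_intros)
  then show ?thesis
    unfolding res_def by (simp add: mem_collect)
qed

lemma is_restriction_iff [simp]: "is_restriction g f d \<longleftrightarrow> g = res f d"
  using extensionality[of g "res f d"] by (auto simp: is_restriction_def mem_res)

lemma app_res [simp]: "app (res f d) x y \<longleftrightarrow> app f x y \<and> x \<epsilon> d"
  by (auto simp: app_iff mem_res)

lemma res_res: "subset c d \<Longrightarrow> res (res f d) c = res f c"
  by (rule extensionality) (auto simp: mem_res subset_def)

lemma fun_on_app:
  assumes "fun_on f d"
  shows "app f x y \<longleftrightarrow> x \<epsilon> d \<and> y = val f x"
proof -
  have dom: "x \<epsilon> d" if "app f x y" for y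
    using assms that unfolding fun_on_def app_iff by fastforce
  have "app f x (val f x)" if "x \<epsilon> d"
    using assms that unfolding fun_on_def val_def by (blast intro: theI')
  then show ?thesis
    using dom assms unfolding fun_on_def by blast
qed

lemma fun_on_mem:
  assumes "fun_on f d"
  shows "p \<epsilon> f \<longleftrightarrow> (\<exists>x. x \<epsilon> d \<and> p = pair x (val f x))"
proof
  assume "p \<epsilon> f"
  then obtain x y where "p = pair x y"
    using assms unfolding fun_on_def by auto
  then show "\<exists>x. x \<epsilon> d \<and> p = pair x (val f x)"
    using \<open>p \<epsilon> f\<close> fun_on_app[OF assms, of x y] by (auto simp: app_iff)
qed (use fun_on_app[OF assms] in \<open>auto simp: app_iff\<close>)

lemma fun_eqI:
  assumes "fun_on f d" "fun_on g d" "\<And>x. x \<epsilon> d \<Longrightarrow> val f x = val g x"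
  shows "f = g"
  by (rule extensionality) (use assms(3) in \<open>auto simp: fun_on_mem[OF assms(1)] fun_on_mem[OF assms(2)]\<close>)

lemma fun_onI:
  assumes "\<And>p. p \<epsilon> f \<Longrightarrow> \<exists>x y. x \<epsilon> d \<and> p = pair x y" "\<And>x. x \<epsilon> d \<Longrightarrow> \<exists>!y. app f x y"
  shows "fun_on f d"
  using assms unfolding fun_on_def by auto

lemma val_eqI: "fun_on f d \<Longrightarrow> app f x y \<Longrightarrow> val f x = y"
  by (simp add: fun_on_app)

lemma fun_on_res:
  assumes "fun_on f d" "subset c d"
  shows "fun_on (res f c) c" "x \<epsilon> c \<Longrightarrow> val (res f c) x = val f x"
proof -
  show "fun_on (res f c) c"
  proof (rule fun_onI)
    show "\<exists>x y. x \<epsilon> c \<and> p = pair x y" if "p \<epsilon> res f c" for p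
      using that by (auto simp: mem_res)
  qed (use assms in \<open>auto simp: fun_on_app[OF assms(1)] subset_def\<close>)
  then show "x \<epsilon> c \<Longrightarrow> val (res f c) x = val f x"
    using assms by (auto intro!: val_eqI simp: fun_on_app[OF assms(1)] subset_def)
qed

lemma res_self: "fun_on f d \<Longrightarrow> res f d = f"
  by (rule extensionality) (auto simp: mem_res fun_on_mem)

text \<open>Replacement is applied to the map from \<open>x\<close> to the pair of \<open>x\<close>
  and its value, so that its image is the function itself.\<close>

lemma fun_exists:
  assumes "class_definable (\<lambda>e. F (e 0) (e 1))" "\<And>x. x \<epsilon> d \<Longrightarrow> \<exists>!y. F x y"
  shows "\<exists>f. fun_on f d \<and> (\<forall>x. x \<epsilon> d \<longrightarrow> F x (val f x))"
proof -
  have "class_definable (\<lambda>e. \<exists>y. F (e 0) y \<and> is_pair (e 1) (e 0) y)"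
    by (intro definable_class_intros definable_subst2[OF transitive_domain_UNIV assms(1)])
  then have "\<exists>b. \<forall>p. p \<epsilon> b \<longleftrightarrow> (\<exists>x. x \<epsilon> d \<and> (\<exists>y. F x y \<and> is_pair p x y))"
    by (rule definable_replacement) (use assms(2) in auto)
  then obtain f where f: "\<And>p. p \<epsilon> f \<longleftrightarrow> (\<exists>x. x \<epsilon> d \<and> (\<exists>y. F x y \<and> p = pair x y))"
    by auto
  have app: "app f x y \<longleftrightarrow> x \<epsilon> d \<and> F x y" for x y
    by (auto simp: app_iff f)
  have "fun_on f d"
    by (rule fun_onI) (use assms(2) in \<open>auto simp: app f\<close>)
  then show ?thesis
    using app fun_on_app by blast
qed

definition extend :: "'a \<Rightarrow> 'a \<Rightarrow> 'a \<Rightarrow> 'a" where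
  "extend f d y = join f (upair (pair d y) (pair d y))"

lemma app_extend: "app (extend f d y) x z \<longleftrightarrow> app f x z \<or> x = d \<and> z = y"
  by (simp add: app_iff extend_def)

lemma fun_on_extend:
  assumes "fun_on f d"
  shows "fun_on (extend f d y) (suc d)"
proof (rule fun_onI)
  show "\<exists>x z. x \<epsilon> suc d \<and> p = pair x z" if "p \<epsilon> extend f d y" for p
    using that by (auto simp: extend_def fun_on_mem[OF assms])
  show "\<exists>!z. app (extend f d y) x z" if "x \<epsilon> suc d" for x
    using that by (auto simp: app_extend fun_on_app[OF assms])
qed

lemma val_extend:
  assumes "fun_on f d"
  shows "val (extend f d y) d = y" "x \<epsilon> d \<Longrightarrow> val (extend f d y) x = val f x"
  by (rule val_eqI[OF fun_on_extend[OF assms]], auto simp: app_extend fun_on_app[OF assms])+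

lemma fun_on_zero: "fun_on zero zero"
  by (simp add: fun_on_def)

text \<open>Course-of-values recursion inside the model: approximations of each length exist and are
  unique by induction, and the value at \<open>n\<close> is read off the approximation of length
  \<open>suc n\<close>.\<close>

lemma omega_recursion:
  assumes definable: "class_definable (\<lambda>e. \<Gamma> (e 0) (e 1) (e 2))"
    and ex1: "\<And>n p. n \<epsilon> omega \<Longrightarrow> fun_on p n \<Longrightarrow> \<exists>!y. \<Gamma> n p y"
  shows "\<exists>x. fun_on x omega \<and> (\<forall>n. n \<epsilon> omega \<longrightarrow> \<Gamma> n (res x n) (val x n))"
proof -
  define approx where "approx n p \<longleftrightarrow> fun_on p n \<and>
    (\<forall>k. k \<epsilon> n \<longrightarrow> (\<exists>y q. app p k y \<and> is_restriction q p k \<and> \<Gamma> k q y))" for n p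
  have approx_iff: "approx n p \<longleftrightarrow> fun_on p n \<and> (\<forall>k. k \<epsilon> n \<longrightarrow> \<Gamma> k (res p k) (val p k))" for n p
    by (auto simp: approx_def fun_on_app)
  have definable_approx: "class_definable (\<lambda>e. approx (e 0) (e 1))"
    unfolding approx_def
    by (intro definable_class_intros definable_subst3[OF transitive_domain_UNIV definable])
  have unique: "p = q" if n: "n \<epsilon> omega" and p: "approx n p" and q: "approx n q" for n p q
  proof -
    have fp: "fun_on p n" and fq: "fun_on q n"
      using p q by (auto simp: approx_iff)
    \<comment> \<open>Agreement is proved below \<open>k\<close> and only within the common domain
      \<open>n\<close>, so \<open>k\<close> may range over all of \<open>omega\<close>.\<close>
    have "\<forall>j. j \<epsilon> k \<longrightarrow> j \<epsilon> n \<longrightarrow> (\<forall>y. app p j y \<longleftrightarrow> app q j y)" if "k \<epsilon> omega" for k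
      using that
    proof (induction k rule: omega_induct)
      case definable
      show ?case by (intro definable_class_intros)
    next
      case (suc k)
      have "val p k = val q k" if "k \<epsilon> n"
      proof -
        have sub: "subset k n"
          using nat_transitive n that by (auto simp: subset_def)
        have "val p j = val q j" if "j \<epsilon> k" for j
          using suc.IH sub that fun_on_app[OF fp, of j] fun_on_app[OF fq, of j]
          unfolding subset_def by blast
        then have "res p k = res q k"
          by (intro fun_eqI[OF fun_on_res(1)[OF fp sub] fun_on_res(1)[OF fq sub]])
             (simp add: fun_on_res(2)[OF fp sub] fun_on_res(2)[OF fq sub])
        moreover have "\<exists>!y. \<Gamma> k (res p k) y"
          by (rule ex1[OF suc.hyps fun_on_res(1)[OF fp sub]])
        ultimately show ?thesis
          using p q that unfolding approx_iff by metis
      qed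
      then show ?case
        using suc by (auto simp: fun_on_app[OF fp] fun_on_app[OF fq])
    qed auto
    from this[OF n] show "p = q"
      by (intro fun_eqI[OF fp fq]) (auto simp: fun_on_app[OF fp] fun_on_app[OF fq])
  qed
  have restrict: "approx m (res p m)" if p: "approx n p" and "n \<epsilon> omega" "subset m n" "m \<epsilon> omega" for n m p
  proof -
    have "fun_on p n"
      using p by (simp add: approx_iff)
    note f = fun_on_res[OF this \<open>subset m n\<close>]
    have "res (res p m) k = res p k" "k \<epsilon> n" if "k \<epsilon> m" for k
      using nat_transitive[OF \<open>m \<epsilon> omega\<close> that] \<open>subset m n\<close> that by (auto intro!: res_res simp: subset_def)
    then show ?thesis
      using p f by (simp add: approx_iff)
  qed
  have exists: "\<exists>p. approx n p" if "n \<epsilon> omega" for n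
    using that
  proof (induction n rule: omega_induct)
    case definable
    show ?case
      by (intro definable_class_intros definable_subst2[OF transitive_domain_UNIV definable_approx])
  next
    case zero
    show ?case
      by (intro exI[of _ zero]) (simp add: approx_iff fun_on_zero)
  next
    case (suc n)
    then obtain p where p: "approx n p" by blast
    then have f: "fun_on p n" by (simp add: approx_iff)
    then obtain y where y: "\<Gamma> n p y"
      using ex1[OF suc.hyps] by blast
    \<comment> \<open>The added pair has first component \<open>n\<close>, which is not a member of
      any such \<open>k\<close>.\<close>
    have res: "res (extend p n y) k = res p k" if "k \<epsilon> suc n" for k
      using that not_mem_cycle[of n k]
      by (intro extensionality) (auto simp: extend_def mem_res)
    have "approx (suc n) (extend p n y)"
      using p y by (auto simp: approx_iff fun_on_extend res val_extend f res_self)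
    then show ?case by blast
  qed
  have "class_definable (\<lambda>e. \<exists>s p. is_succ s (e 0) \<and> approx s p \<and> app p (e 0) (e 1))"
    by (intro definable_class_intros definable_subst2[OF transitive_domain_UNIV definable_approx])
  then have "\<exists>x. fun_on x omega \<and> (\<forall>n. n \<epsilon> omega \<longrightarrow>
      (\<exists>s p. is_succ s n \<and> approx s p \<and> app p n (val x n)))"
  proof (rule fun_exists)
    fix n assume "n \<epsilon> omega"
    then obtain p where p: "approx (suc n) p" and only_p: "\<And>q. approx (suc n) q \<Longrightarrow> q = p"
      using exists[of "suc n"] unique[of "suc n"] by auto
    have "(\<exists>s p. is_succ s n \<and> approx s p \<and> app p n y) \<longleftrightarrow> app p n y" for y
      unfolding is_succ_iff using p only_p by blast
    then show "\<exists>!y. \<exists>s p. is_succ s n \<and> approx s p \<and> app p n y"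
      using p fun_on_app[of p "suc n" n] by (simp add: approx_iff)
  qed
  then obtain x where x: "fun_on x omega"
    and "\<And>n. n \<epsilon> omega \<Longrightarrow> \<exists>p. approx (suc n) p \<and> app p n (val x n)"
    by auto
  \<comment> \<open>\<open>P\<close> is chosen in HOL, outside the model; only \<open>x\<close> has
    to be a set.\<close>
  then obtain P where P: "\<And>n. n \<epsilon> omega \<Longrightarrow> approx (suc n) (P n)"
    "\<And>n. n \<epsilon> omega \<Longrightarrow> app (P n) n (val x n)"
    by metis
  have "\<Gamma> n (res x n) (val x n)" if n: "n \<epsilon> omega" for n
  proof -
    have f: "fun_on (P k) (suc k)" if "k \<epsilon> omega" for k
      using P(1)[OF that] by (simp add: approx_iff)
    have val: "val (P k) k = val x k" if "k \<epsilon> omega" for k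
      using P(2)[OF that] val_eqI[OF f[OF that]] by simp
    have sub: "subset n omega" "subset n (suc n)"
      using n omega_transitive by (auto simp: subset_def)
    \<comment> \<open>Approximations of different lengths cohere: cutting \<open>P n\<close> at
      \<open>suc k\<close> gives \<open>P k\<close> by uniqueness.\<close>
    have "res x n = res (P n) n"
    proof (rule fun_eqI[OF fun_on_res(1)[OF x sub(1)] fun_on_res(1)[OF f[OF n] sub(2)]])
      fix k assume k: "k \<epsilon> n"
      then have "k \<epsilon> omega"
        using n omega_transitive by blast
      have "subset (suc k) (suc n)"
        using k nat_transitive[OF n k] by (auto simp: subset_def)
      then have "approx (suc k) (res (P n) (suc k))"
        using n \<open>k \<epsilon> omega\<close> by (intro restrict[OF P(1)]) auto
      then have "res (P n) (suc k) = P k"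
        using unique[OF suc_mem_omega[OF \<open>k \<epsilon> omega\<close>] _ P(1)[OF \<open>k \<epsilon> omega\<close>]] by blast
      then have "val (P n) k = val (P k) k"
        using fun_on_res(2)[OF f[OF n] \<open>subset (suc k) (suc n)\<close>, of k] by simp
      then show "val (res x n) k = val (res (P n) n) k"
        using k val[OF \<open>k \<epsilon> omega\<close>] by (simp add: fun_on_res[OF x sub(1)] fun_on_res[OF f[OF n] sub(2)])
    qed
    then show ?thesis
      using P(1)[OF n] val[OF n] by (simp add: approx_iff)
  qed
  then show ?thesis
    using x by blast
qed

subsection \<open>Parity\<close>

definition adjoin :: "'a \<Rightarrow> 'a \<Rightarrow> 'a" where
  "adjoin r m = join r (upair m m)"

text \<open>A bounded relational form of \<open>adjoin\<close>, usable in formulas interpreted in a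
  level.\<close>

definition is_adjoin :: "'a \<Rightarrow> 'a \<Rightarrow> 'a \<Rightarrow> bool" where
  "is_adjoin s r m \<longleftrightarrow> (\<forall>z. z \<epsilon> s \<longrightarrow> z \<epsilon> r \<or> z = m) \<and> (\<forall>z. z \<epsilon> r \<longrightarrow> z \<epsilon> s) \<and> m \<epsilon> s"

lemma mem_adjoin [simp]: "z \<epsilon> adjoin r m \<longleftrightarrow> z \<epsilon> r \<or> z = m"
  by (simp add: adjoin_def)

lemma is_adjoin_iff [simp]: "is_adjoin s r m \<longleftrightarrow> s = adjoin r m"
  using extensionality[of s "adjoin r m"] by (auto simp: is_adjoin_def)

lemma definable_is_adjoin:
  assumes "transitive_domain E D C" "is_term C s" "is_term C t" "is_term C u"
  shows "definable E D C (\<lambda>e. is_adjoin (s e) (t e) (u e))"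
  by (rule definable_subst3[OF assms(1) _ assms(2-4)])
     (unfold is_adjoin_def, intro definable_intros assms(1))

text \<open>\<open>k\<close> belongs to the parity set of \<open>r\<close> iff \<open>r\<close> has an odd number of elements below \<open>k\<close>.\<close>

definition parity_of :: "'a \<Rightarrow> 'a \<Rightarrow> bool" where
  "parity_of r t \<longleftrightarrow> subset t omega \<and> \<not> zero \<epsilon> t \<and>
     (\<forall>k. k \<epsilon> omega \<longrightarrow> ((\<exists>s. is_succ s k \<and> s \<epsilon> t) \<longleftrightarrow> \<not> (k \<epsilon> t \<longleftrightarrow> k \<epsilon> r)))"

lemma parity_of_suc: "parity_of r t \<Longrightarrow> k \<epsilon> omega \<Longrightarrow> suc k \<epsilon> t \<longleftrightarrow> \<not> (k \<epsilon> t \<longleftrightarrow> k \<epsilon> r)"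
  by (simp add: parity_of_def)

lemma definable_parity_of:
  assumes "is_term UNIV s" "is_term UNIV t"
  shows "class_definable (\<lambda>e. parity_of (s e) (t e))"
  by (rule definable_subst2[OF transitive_domain_UNIV _ assms])
     (unfold parity_of_def, intro definable_class_intros)

text \<open>Recursion yields the 0-1 indicator of the parity set; Separation then extracts the
  set.\<close>

lemma ex_parity: "\<exists>t. parity_of r t"
proof -
  let ?one = "suc zero"
  \<comment> \<open>The parity at \<open>n\<close> is that at its predecessor \<open>k\<close>,
    switched iff \<open>k \<epsilon> r\<close>. At zero there is no predecessor, so the count starts
    as even.\<close>
  define odd_step where
    "odd_step n p \<longleftrightarrow> (\<exists>k. k \<epsilon> omega \<and> is_succ n k \<and> \<not> (app p k ?one \<longleftrightarrow> k \<epsilon> r))" for n p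
  have "class_definable (\<lambda>e. odd_step (e 0) (e 1) \<and> e 2 = ?one \<or> \<not> odd_step (e 0) (e 1) \<and> e 2 = zero)"
    unfolding odd_step_def by (intro definable_class_intros)
  then have "\<exists>x. fun_on x omega \<and> (\<forall>n. n \<epsilon> omega \<longrightarrow>
      (odd_step n (res x n) \<and> val x n = ?one \<or> \<not> odd_step n (res x n) \<and> val x n = zero))"
    by (rule omega_recursion) auto
  then obtain x where x: "fun_on x omega"
    and val: "\<And>n. n \<epsilon> omega \<Longrightarrow> val x n = ?one \<longleftrightarrow> odd_step n (res x n)"
    by force
  have "class_definable (\<lambda>e. app x (e 0) ?one)"
    by (intro definable_class_intros)
  from definable_separation[OF this] obtain t where t: "\<And>k. k \<epsilon> t \<longleftrightarrow> k \<epsilon> omega \<and> app x k ?one"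
    by blast
  have t_iff: "k \<epsilon> t \<longleftrightarrow> k \<epsilon> omega \<and> val x k = ?one" for k
    by (auto simp: t fun_on_app[OF x])
  have "val x zero \<noteq> ?one"
    by (simp add: val odd_step_def)
  moreover have "val x (suc k) = ?one \<longleftrightarrow> \<not> (val x k = ?one \<longleftrightarrow> k \<epsilon> r)" if "k \<epsilon> omega" for k
    using val[OF suc_mem_omega[OF that]] that
    by (simp add: odd_step_def fun_on_app[OF x] eq_commute[of "?one"])
  ultimately have "parity_of r t"
    by (auto simp: parity_of_def subset_def t_iff)
  then show ?thesis
    by blast
qed

lemma parity_unique:
  assumes t: "parity_of r t" and u: "parity_of r u"
  shows "t = u"
proof (rule extensionality)
  have "k \<epsilon> t \<longleftrightarrow> k \<epsilon> u" if "k \<epsilon> omega" for k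
    using that
  proof (induction k rule: omega_induct)
    case definable
    show ?case by (intro definable_class_intros)
  next
    case zero
    show ?case using t u by (simp add: parity_of_def)
  next
    case (suc k)
    then show ?case using t u by (simp add: parity_of_suc)
  qed
  then show "\<forall>k. k \<epsilon> t \<longleftrightarrow> k \<epsilon> u"
    using t u by (auto simp: parity_of_def subset_def)
qed

lemma first_index_nat:
  shows first_index_zero: "first_index zero"
    and first_index_suc: "n \<epsilon> omega \<Longrightarrow> first_index (suc n) \<longleftrightarrow> \<not> first_index n"
proof -
  \<comment> \<open>The parity set of \<open>omega\<close> consists of the odd numbers, so its
    complement \<open>J\<close> is the expected set of the first player's indices.\<close>
  obtain t where t: "parity_of omega t"
    using ex_parity by blast
  then have zero: "\<not> zero \<epsilon> t" and suc: "k \<epsilon> omega \<Longrightarrow> suc k \<epsilon> t \<longleftrightarrow> \<not> k \<epsilon> t" for k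
    by (auto simp: parity_of_suc) (simp add: parity_of_def)
  have "class_definable (\<lambda>e. \<not> e 0 \<epsilon> t)"
    by (intro definable_class_intros)
  from definable_separation[OF this] obtain J where J: "\<And>k. k \<epsilon> J \<longleftrightarrow> k \<epsilon> omega \<and> \<not> k \<epsilon> t"
    by blast
  have J_rec: "b \<epsilon> J \<longleftrightarrow> \<not> (\<exists>c. is_succ b c \<and> c \<epsilon> J)" if "b \<epsilon> omega" for b
    using that by (cases b rule: omega_cases) (auto simp: J zero suc)
  have "first_index n \<longleftrightarrow> n \<epsilon> J" if n: "n \<epsilon> omega" for n
  proof
    assume "n \<epsilon> J"
    moreover have "\<forall>b. b \<epsilon> suc n \<longrightarrow> (b \<epsilon> J \<longleftrightarrow> \<not> (\<exists>c. is_succ b c \<and> c \<epsilon> J))"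
      using J_rec omega_transitive[of "suc n"] n by simp
    ultimately show "first_index n"
      unfolding first_index_def using is_succ_iff by blast
  next
    assume "first_index n"
    then obtain I where "\<forall>b. b \<epsilon> suc n \<longrightarrow> (b \<epsilon> I \<longleftrightarrow> \<not> (\<exists>c. is_succ b c \<and> c \<epsilon> I))" and "n \<epsilon> I"
      unfolding first_index_def is_succ_iff[of _ n] by blast
    then have I: "b \<epsilon> I \<longleftrightarrow> \<not> (\<exists>c. b = suc c \<and> c \<epsilon> I)" if "b \<epsilon> suc n" for b
      unfolding is_succ_iff using that by blast
    \<comment> \<open>The bound stays inside the induction because \<open>I\<close> is constrained
      only up to \<open>n\<close>.\<close>
    have "b \<epsilon> suc n \<longrightarrow> (b \<epsilon> I \<longleftrightarrow> b \<epsilon> J)" if "b \<epsilon> omega" for b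
      using that
    proof (induction b rule: omega_induct)
      case definable
      show ?case by (intro definable_class_intros)
    next
      case zero
      show ?case
        using I[of zero] by (auto simp: J \<open>\<not> zero \<epsilon> t\<close>)
    next
      case (suc b)
      show ?case
      proof
        assume "suc b \<epsilon> suc n"
        moreover from this have "b \<epsilon> suc n"
          using nat_transitive[of "suc n" "suc b" b] n by simp
        ultimately show "suc b \<epsilon> I \<longleftrightarrow> suc b \<epsilon> J"
          using I[of "suc b"] J_rec[of "suc b"] suc by auto
      qed
    qed
    then show "n \<epsilon> J"
      using n \<open>n \<epsilon> I\<close> by simp
  qed
  then show "first_index zero" "n \<epsilon> omega \<Longrightarrow> first_index (suc n) \<longleftrightarrow> \<not> first_index n"
    by (auto simp: J zero suc)
qed

text \<open>
  The parity sets of \<open>r\<close> and \<open>s\<close> eventually agree (\<open>b\<close> true) or eventually differ (\<open>b\<close> false):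
  \<open>r\<close> and \<open>s\<close> differ in finitely many elements, evenly or oddly many of them.
\<close>

definition tail_rel :: "bool \<Rightarrow> 'a \<Rightarrow> 'a \<Rightarrow> bool" where
  "tail_rel b r s \<longleftrightarrow> (\<exists>t u n. parity_of r t \<and> parity_of s u \<and> n \<epsilon> omega \<and>
     (\<forall>k. k \<epsilon> omega \<longrightarrow> \<not> k \<epsilon> n \<longrightarrow> ((k \<epsilon> t \<longleftrightarrow> k \<epsilon> u) \<longleftrightarrow> b)))"

lemma definable_tail_rel:
  assumes "is_term UNIV s" "is_term UNIV t"
  shows "class_definable (\<lambda>e. tail_rel b (s e) (t e))"
  by (rule definable_subst2[OF transitive_domain_UNIV _ assms])
     (unfold tail_rel_def, intro definable_class_intros definable_parity_of definable_const)

lemma tail_rel_refl: "tail_rel True r r"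
  using ex_parity[of r] zero_mem_omega unfolding tail_rel_def by blast

lemma tail_rel_sym: "tail_rel b r s \<Longrightarrow> tail_rel b s r"
  unfolding tail_rel_def by metis

lemma nat_upper_bound:
  assumes "m \<epsilon> omega" "n \<epsilon> omega"
  obtains N where "N \<epsilon> omega" "subset m N" "subset n N"
proof -
  consider "m \<epsilon> n" | "m = n" | "n \<epsilon> m"
    using nat_linear assms by blast
  then show ?thesis
    using that assms nat_transitive unfolding subset_def by cases metis+
qed

text \<open>Parities of differences add up: two changes of the same kind amount to an even
  one.\<close>

lemma tail_rel_trans:
  assumes "tail_rel b r s" "tail_rel c s u"
  shows "tail_rel (b \<longleftrightarrow> c) r u"
proof -
  obtain t1 t2 n where 1: "parity_of r t1" "parity_of s t2" "n \<epsilon> omega"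
    "\<And>k. k \<epsilon> omega \<Longrightarrow> \<not> k \<epsilon> n \<Longrightarrow> (k \<epsilon> t1 \<longleftrightarrow> k \<epsilon> t2) \<longleftrightarrow> b"
    using assms(1) unfolding tail_rel_def by blast
  obtain t2' t3 m where 2: "parity_of s t2'" "parity_of u t3" "m \<epsilon> omega"
    "\<And>k. k \<epsilon> omega \<Longrightarrow> \<not> k \<epsilon> m \<Longrightarrow> (k \<epsilon> t2' \<longleftrightarrow> k \<epsilon> t3) \<longleftrightarrow> c"
    using assms(2) unfolding tail_rel_def by blast
  have [simp]: "t2' = t2"
    using parity_unique 1(2) 2(1) by blast
  obtain N where N: "N \<epsilon> omega" "subset n N" "subset m N"
    using nat_upper_bound 1(3) 2(3) by blast
  have "(k \<epsilon> t1 \<longleftrightarrow> k \<epsilon> t3) \<longleftrightarrow> (b \<longleftrightarrow> c)" if "k \<epsilon> omega" "\<not> k \<epsilon> N" for k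
    using 1(4)[of k] 2(4)[of k] N that unfolding subset_def by auto
  then show ?thesis
    using 1(1) 2(2) N(1) unfolding tail_rel_def by blast
qed

text \<open>Otherwise composing both relations yields \<open>tail_rel False r r\<close>,
  contradicting uniqueness of parity sets already at the index \<open>n\<close> itself.\<close>

lemma tail_rel_exclusive: "tail_rel True r s \<Longrightarrow> \<not> tail_rel False r s"
proof
  assume "tail_rel True r s" "tail_rel False r s"
  then have "tail_rel False r r"
    using tail_rel_trans[of True r s False r] tail_rel_sym by simp
  then obtain t u n where "parity_of r t" "parity_of r u" "n \<epsilon> omega"
    "\<And>k. k \<epsilon> omega \<Longrightarrow> \<not> k \<epsilon> n \<Longrightarrow> \<not> (k \<epsilon> t \<longleftrightarrow> k \<epsilon> u)"
    unfolding tail_rel_def by auto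
  then show False
    using parity_unique[of r t u] not_mem_self[of n] by blast
qed

text \<open>The parity sets agree at indices up to \<open>m\<close> and differ at all later
  ones.\<close>

lemma tail_rel_adjoin:
  assumes "m \<epsilon> omega" "\<not> m \<epsilon> r"
  shows "tail_rel False r (adjoin r m)"
proof -
  obtain t u where t: "parity_of r t" and u: "parity_of (adjoin r m) u"
    using ex_parity by blast
  have "(\<not> m \<epsilon> k \<longrightarrow> (k \<epsilon> t \<longleftrightarrow> k \<epsilon> u)) \<and> (m \<epsilon> k \<longrightarrow> \<not> (k \<epsilon> t \<longleftrightarrow> k \<epsilon> u))" if "k \<epsilon> omega" for k
    using that
  proof (induction k rule: omega_induct)
    case definable
    show ?case by (intro definable_class_intros)
  next
    case zero
    show ?case using t u by (simp add: parity_of_def)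
  next
    case (suc k)
    then show ?case
      using assms by (auto simp: parity_of_suc[OF t] parity_of_suc[OF u])
  qed
  moreover have "m \<epsilon> k" if "k \<epsilon> omega" "\<not> k \<epsilon> suc m" for k
    using nat_linear[OF that(1) assms(1)] that by auto
  ultimately show ?thesis
    unfolding tail_rel_def using t u assms(1) by (metis suc_mem_omega)
qed

section \<open>A set of reals that every one-element change flips\<close>

definition colouring :: "'a \<Rightarrow> bool" where
  "colouring B \<longleftrightarrow> zero \<epsilon> B \<and>
     (\<forall>r s m. subset r omega \<and> m \<epsilon> omega \<and> \<not> m \<epsilon> r \<and> is_adjoin s r m \<longrightarrow> (r \<epsilon> B \<longleftrightarrow> \<not> s \<epsilon> B))"

lemma colouring_zero: "colouring B \<Longrightarrow> zero \<epsilon> B"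
  by (simp add: colouring_def)

lemma colouring_adjoin:
  "colouring B \<Longrightarrow> subset r omega \<Longrightarrow> m \<epsilon> omega \<Longrightarrow> \<not> m \<epsilon> r \<Longrightarrow> adjoin r m \<epsilon> B \<longleftrightarrow> \<not> r \<epsilon> B"
  by (auto simp: colouring_def)

lemma ex_colouring: "\<exists>B. subset B (pow omega) \<and> colouring B"
proof -
  define near where "near r s \<longleftrightarrow> tail_rel True r s \<or> tail_rel False r s" for r s
  have near_refl: "near r r" for r
    by (simp add: near_def tail_rel_refl)
  have near_sym: "near s r" if "near r s" for r s
    using that tail_rel_sym by (auto simp: near_def)
  have near_trans: "near r u" if "near r s" "near s u" for r s u
    using that tail_rel_trans[of _ r s _ u] by (fastforce simp: near_def)
  have definable_near: "class_definable (\<lambda>e. near (s e) (t e))" if "is_term UNIV s" "is_term UNIV t" for s t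
    unfolding near_def by (intro definable_class_intros definable_tail_rel that)
  \<comment> \<open>Choice is available for a set of pairwise disjoint nonempty sets, so the classes
    of \<open>near\<close> are first collected into the set \<open>a\<close>.\<close>
  define is_class where
    "is_class C r \<longleftrightarrow> r \<epsilon> pow omega \<and> (\<forall>s. s \<epsilon> C \<longleftrightarrow> s \<epsilon> pow omega \<and> near r s)" for C r
  have "class_definable (\<lambda>e. \<exists>r. is_class (e 0) r)"
    unfolding is_class_def by (intro definable_class_intros definable_near)
  from definable_separation[OF this] obtain a
    where a: "\<And>C. C \<epsilon> a \<longleftrightarrow> C \<epsilon> pow (pow omega) \<and> (\<exists>r. is_class C r)"
    by blast
  have "\<not> is_empty C" if "C \<epsilon> a" for C
    using that near_refl unfolding a is_class_def is_empty_def by blast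
  moreover have "\<not> (\<exists>z. z \<epsilon> C \<and> z \<epsilon> D)" if "C \<epsilon> a" "D \<epsilon> a" "C \<noteq> D" for C D
  proof
    assume "\<exists>z. z \<epsilon> C \<and> z \<epsilon> D"
    moreover obtain r s where "is_class C r" "is_class D s"
      using \<open>C \<epsilon> a\<close> \<open>D \<epsilon> a\<close> a by blast
    ultimately have "near r u \<longleftrightarrow> near s u" for u
      using near_sym near_trans unfolding is_class_def by metis
    then have "C = D"
      using \<open>is_class C r\<close> \<open>is_class D s\<close> by (intro extensionality) (simp add: is_class_def)
    then show False
      using \<open>C \<noteq> D\<close> by simp
  qed
  ultimately obtain c where c: "\<And>C. C \<epsilon> a \<Longrightarrow> \<exists>!z. z \<epsilon> C \<and> z \<epsilon> c"
    using choice[of a] by blast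
  have rep: "\<exists>!z. z \<epsilon> pow omega \<and> near r z \<and> z \<epsilon> c" if r: "r \<epsilon> pow omega" for r
  proof -
    have "class_definable (\<lambda>e. near r (e 0))"
      by (intro definable_class_intros definable_near)
    from definable_separation[OF this] obtain C where C: "\<And>s. s \<epsilon> C \<longleftrightarrow> s \<epsilon> pow omega \<and> near r s"
      by blast
    then have "C \<epsilon> a"
      using r unfolding a is_class_def by (auto simp: subset_def)
    from c[OF this] show ?thesis
      by (simp add: C conj_assoc)
  qed
  \<comment> \<open>\<open>B\<close> collects the reals at even distance from the chosen
    representative of their class.\<close>
  have "class_definable (\<lambda>e. \<exists>z. z \<epsilon> pow omega \<and> z \<epsilon> c \<and> tail_rel True (e 0) z)"
    by (intro definable_class_intros definable_tail_rel)
  from definable_separation[OF this] obtain B where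
    B: "\<And>r. r \<epsilon> B \<longleftrightarrow> r \<epsilon> pow omega \<and> (\<exists>z. z \<epsilon> pow omega \<and> z \<epsilon> c \<and> tail_rel True r z)"
    by blast
  have flip: "r \<epsilon> B \<longleftrightarrow> \<not> adjoin r m \<epsilon> B" if "subset r omega" "m \<epsilon> omega" "\<not> m \<epsilon> r" for r m
  proof -
    let ?s = "adjoin r m"
    have r: "r \<epsilon> pow omega" and s: "?s \<epsilon> pow omega"
      using that by (auto simp: subset_def)
    have F: "tail_rel False r ?s"
      using tail_rel_adjoin that by blast
    then have "near r ?s"
      by (simp add: near_def)
    obtain z where z: "z \<epsilon> pow omega" "near r z" "z \<epsilon> c"
      and only: "\<And>z'. z' \<epsilon> pow omega \<Longrightarrow> near r z' \<Longrightarrow> z' \<epsilon> c \<Longrightarrow> z' = z"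
      using rep[OF r] by blast
    have "r \<epsilon> B \<longleftrightarrow> tail_rel True r z"
      using z only r unfolding B near_def by blast
    moreover have "?s \<epsilon> B \<longleftrightarrow> tail_rel True ?s z"
      using z only s near_trans[OF \<open>near r ?s\<close>] unfolding B near_def by blast
    \<comment> \<open>Both reals have the same representative \<open>z\<close>, and adding
      \<open>m\<close> reverses the parity of the distance to it.\<close>
    moreover have shift: "tail_rel b r z \<longleftrightarrow> tail_rel (\<not> b) ?s z" for b
    proof
      show "tail_rel (\<not> b) ?s z" if "tail_rel b r z"
        using tail_rel_trans[OF tail_rel_sym[OF F] that] by simp
      show "tail_rel b r z" if "tail_rel (\<not> b) ?s z"
        using tail_rel_trans[OF F that] by simp
    qed
    ultimately show ?thesis
      using z(2) tail_rel_exclusive[of r z] shift[of False] unfolding near_def by simp blast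
  qed
  show ?thesis
  proof (cases "zero \<epsilon> B")
    case True
    have "colouring B"
      using True flip by (auto simp: colouring_def)
    moreover have "subset B (pow omega)"
      by (auto simp: subset_def[of B] B)
    ultimately show ?thesis
      by blast
  next
    case False
    \<comment> \<open>The complement of \<open>B\<close> flips in the same way and contains the
      empty set.\<close>
    have "class_definable (\<lambda>e. \<not> e 0 \<epsilon> B)"
      by (intro definable_class_intros)
    from definable_separation[OF this] obtain B' where B': "\<And>r. r \<epsilon> B' \<longleftrightarrow> r \<epsilon> pow omega \<and> \<not> r \<epsilon> B"
      by blast
    have "adjoin r m \<epsilon> pow omega" if "subset r omega" "m \<epsilon> omega" for r m
      using that by (auto simp: subset_def)
    then have "colouring B'"
      using False flip by (auto simp: colouring_def B' subset_def[of zero])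
    moreover have "subset B' (pow omega)"
      by (auto simp: subset_def[of B'] B')
    ultimately show ?thesis
      by blast
  qed
qed

subsection \<open>The cumulative hierarchy\<close>

definition transitive_set :: "'a \<Rightarrow> bool" where
  "transitive_set v \<longleftrightarrow> (\<forall>x. x \<epsilon> v \<longrightarrow> subset x v)"

lemma transitive_set_pow:
  assumes "transitive_set v"
  shows "transitive_set (pow v)" "subset v (pow v)"
  using assms by (auto simp: transitive_set_def subset_def)

definition hierarchy_clause :: "'a \<Rightarrow> 'a \<Rightarrow> 'a \<Rightarrow> bool" where
  "hierarchy_clause f b v \<longleftrightarrow>
     (is_empty b \<longrightarrow> is_empty v) \<and>
     (\<forall>c u. is_succ b c \<and> app f c u \<longrightarrow> is_power v u) \<and>
     (limit_ordinal b \<longrightarrow> (\<forall>x. x \<epsilon> v \<longleftrightarrow> (\<exists>c u. c \<epsilon> b \<and> app f c u \<and> x \<epsilon> u)))"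

lemma hierarchy_iff:
  "hierarchy f a \<longleftrightarrow> ordinal a \<and> fun_on f (suc a) \<and> (\<forall>b v. app f b v \<longrightarrow> hierarchy_clause f b v)"
  unfolding hierarchy_def hierarchy_clause_def by simp

text \<open>The clause at \<open>b\<close> consults \<open>f\<close> only at members of
  \<open>b\<close>, so extending a hierarchy does not disturb its earlier entries.\<close>

lemma hierarchy_clause_cong:
  assumes "\<And>c u. c \<epsilon> b \<Longrightarrow> app f c u \<longleftrightarrow> app g c u"
  shows "hierarchy_clause f b v \<longleftrightarrow> hierarchy_clause g b v"
proof -
  have "(is_succ b c \<and> app f c u) \<longleftrightarrow> (is_succ b c \<and> app g c u)"
    "(c \<epsilon> b \<and> app f c u \<and> x \<epsilon> u) \<longleftrightarrow> (c \<epsilon> b \<and> app g c u \<and> x \<epsilon> u)" for c u x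
    using assms by auto
  then show ?thesis
    unfolding hierarchy_clause_def by presburger
qed

lemma ordinal_suc: "ordinal a \<Longrightarrow> ordinal (suc a)"
  unfolding ordinal_def subset_def by auto

lemma not_limit_suc: "\<not> limit_ordinal (suc a)"
  by (simp add: limit_ordinal_def)

lemma is_V_suc:
  assumes "is_V v a"
  shows "is_V (pow v) (suc a)"
proof -
  obtain f where f: "hierarchy f a" "app f a v"
    using assms unfolding is_V_def by blast
  let ?g = "extend f (suc a) (pow v)"
  have fun_f: "fun_on f (suc a)" and ord: "ordinal a"
    using f(1) by (auto simp: hierarchy_iff)
  have "hierarchy_clause ?g b w" if "app ?g b w" for b w
  proof (cases "b \<epsilon> suc a")
    case True
    then have "app f b w"
      using that not_mem_self[of "suc a"] unfolding app_extend by blast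
    then have "hierarchy_clause f b w"
      using f(1) by (simp add: hierarchy_iff)
    moreover have "app f c u \<longleftrightarrow> app ?g c u" if "c \<epsilon> b" for c u
      using that True not_mem_cycle by (auto simp: app_extend)
    ultimately show ?thesis
      using hierarchy_clause_cong by blast
  next
    case False
    then have "b = suc a" "w = pow v"
      using that by (auto simp: app_extend fun_on_app[OF fun_f])
    moreover have "a \<noteq> suc a"
      by (metis mem_suc not_mem_self)
    ultimately show ?thesis
      using f(2) by (auto simp: hierarchy_clause_def not_limit_suc app_extend fun_on_app[OF fun_f])
  qed
  moreover have "ordinal (suc a)" "fun_on ?g (suc (suc a))"
    using ordinal_suc ord fun_on_extend fun_f by auto
  ultimately have "hierarchy ?g (suc a)"
    by (simp add: hierarchy_iff)
  then show ?thesis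
    unfolding is_V_def by (auto intro: exI[of _ ?g] simp: app_extend)
qed

text \<open>The finite levels come from recursion and their union from Replacement. Transitivity and
  \<open>subset omega v\<close> serve to locate reals, moves and plays in the levels above.\<close>

lemma ex_V_omega: "\<exists>v. is_V v omega \<and> transitive_set v \<and> subset omega v"
proof -
  define step where
    "step n p y \<longleftrightarrow> (is_empty n \<and> is_empty y) \<or> (\<exists>k u. is_succ n k \<and> app p k u \<and> is_power y u)"
    for n p y
  have "class_definable (\<lambda>e. step (e 0) (e 1) (e 2))"
    unfolding step_def by (intro definable_class_intros)
  then have "\<exists>x. fun_on x omega \<and> (\<forall>n. n \<epsilon> omega \<longrightarrow> step n (res x n) (val x n))"
  proof (rule omega_recursion)
    show "\<exists>!y. step n p y" if "n \<epsilon> omega" "fun_on p n" for n p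
      using that(1) by (cases n rule: omega_cases) (use that(2) in \<open>auto simp: step_def fun_on_app\<close>)
  qed
  then obtain x where x: "fun_on x omega"
    and step: "\<And>n. n \<epsilon> omega \<Longrightarrow> step n (res x n) (val x n)"
    by blast
  have zero: "val x zero = zero"
    using step[of zero] by (auto simp: step_def)
  have suc: "val x (suc n) = pow (val x n)" if "n \<epsilon> omega" for n
    using step[of "suc n"] that by (auto simp: step_def fun_on_app[OF x])
  have "class_definable (\<lambda>e. app x (e 0) (e 1))"
    by (intro definable_class_intros)
  then have "\<exists>b. \<forall>u. u \<epsilon> b \<longleftrightarrow> (\<exists>n. n \<epsilon> omega \<and> app x n u)"
    by (rule definable_replacement) (simp add: fun_on_app[OF x])
  then obtain b where "\<And>u. u \<epsilon> b \<longleftrightarrow> (\<exists>n. n \<epsilon> omega \<and> app x n u)"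
    by blast
  then obtain v where v: "\<And>z. z \<epsilon> v \<longleftrightarrow> (\<exists>n. n \<epsilon> omega \<and> z \<epsilon> val x n)"
    using mem_bigunion[of _ b] by (metis fun_on_app[OF x])
  let ?f = "extend x omega v"
  have app: "app ?f b w \<longleftrightarrow> b \<epsilon> omega \<and> w = val x b \<or> b = omega \<and> w = v" for b w
    by (auto simp: app_extend fun_on_app[OF x])
  have "hierarchy_clause ?f b w" if "app ?f b w" for b w
  proof (cases "b \<epsilon> omega")
    case True
    then have w: "w = val x b"
      using that by (auto simp: app)
    show ?thesis
      using True
    proof (cases rule: omega_cases)
      case 1
      then show ?thesis
        using w zero not_limit_nat by (simp add: hierarchy_clause_def)
    next
      case (2 m)
      then show ?thesis
        using w suc by (auto simp: hierarchy_clause_def app not_limit_suc)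
    qed
  next
    case False
    then have "b = omega" "w = v"
      using that by (auto simp: app)
    then show ?thesis
      by (auto simp: hierarchy_clause_def app v)
  qed
  then have "hierarchy ?f omega"
    by (simp add: hierarchy_iff ordinal_omega fun_on_extend[OF x])
  then have "is_V v omega"
    unfolding is_V_def by (intro exI[of _ ?f]) (simp add: app)
  \<comment> \<open>Transitivity passes from a level to its power set, and then from all finite
    levels to their union.\<close>
  moreover have "\<forall>u. app x n u \<longrightarrow> (\<forall>z. z \<epsilon> u \<longrightarrow> subset z u)" if "n \<epsilon> omega" for n
    using that
  proof (induction n rule: omega_induct)
    case definable
    show ?case by (intro definable_class_intros)
  next
    case (suc n)
    then show ?case
      by (auto simp: fun_on_app[OF x] \<open>\<And>n. n \<epsilon> omega \<Longrightarrow> val x (suc n) = pow (val x n)\<close> subset_def)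
  qed (simp add: fun_on_app[OF x] zero)
  then have trans: "subset z (val x n)" if "z \<epsilon> val x n" "n \<epsilon> omega" for z n
    using that by (simp add: fun_on_app[OF x])
  then have "transitive_set v"
    unfolding transitive_set_def subset_def v by blast
  moreover have "\<forall>u. app x n u \<longrightarrow> subset n u" if "n \<epsilon> omega" for n
    using that
  proof (induction n rule: omega_induct)
    case definable
    show ?case by (intro definable_class_intros)
  next
    case zero
    show ?case by (simp add: subset_def)
  next
    case (suc n)
    then have "subset n (val x n)"
      by (simp add: fun_on_app[OF x])
    then show ?case
      using trans \<open>n \<epsilon> omega\<close>
      by (auto simp: fun_on_app[OF x] \<open>\<And>n. n \<epsilon> omega \<Longrightarrow> val x (suc n) = pow (val x n)\<close> subset_def)
  qed
  \<comment> \<open>Being a subset of level \<open>n\<close>, the number \<open>n\<close> is an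
    element of the next level.\<close>
  then have "n \<epsilon> val x (suc n)" if "n \<epsilon> omega" for n
    using that by (simp add: suc fun_on_app[OF x])
  then have "subset omega v"
    unfolding subset_def v using suc_mem_omega by blast
  ultimately show ?thesis
    by blast
qed

subsection \<open>Strategy stealing\<close>

lemma fun_from_toI: "fun_on x d \<Longrightarrow> (\<And>n. n \<epsilon> d \<Longrightarrow> val x n \<epsilon> S) \<Longrightarrow> fun_from_to x d S"
  by (simp add: fun_from_to_def fun_on_app)

lemma fun_from_toD: "fun_from_to x d S \<Longrightarrow> fun_on x d" "fun_from_to x d S \<Longrightarrow> n \<epsilon> d \<Longrightarrow> val x n \<epsilon> S"
  by (auto simp: fun_from_to_def fun_on_app)

lemma fun_on_domain_unique:
  assumes "fun_on f c" "fun_on f d"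
  shows "c = d"
  by (rule extensionality) (metis fun_on_app[OF assms(1)] fun_on_app[OF assms(2)])

text \<open>Kuratowski pairs lie two power sets above their components; this bounds sets of pairs
  and later counts levels.\<close>

lemma pair_mem_pow: "x \<epsilon> A \<Longrightarrow> y \<epsilon> A \<Longrightarrow> pair x y \<epsilon> pow (pow A)"
  by (auto simp: pair_def subset_def)

lemma app_mem_bigunion: "app p x y \<Longrightarrow> y \<epsilon> bigunion (bigunion p)"
  unfolding app_iff pair_def mem_bigunion by (metis mem_upair)

lemma pairs_eqI:
  assumes "\<And>p. p \<epsilon> f \<Longrightarrow> \<exists>x y. p = pair x y" "\<And>p. p \<epsilon> g \<Longrightarrow> \<exists>x y. p = pair x y"
    and "\<And>x y. app f x y \<longleftrightarrow> app g x y"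
  shows "f = g"
  using assms unfolding app_iff by (intro extensionality) metis

text \<open>
  \<open>del d x\<close> is the sequence \<open>x\<close> without its entry at index \<open>d\<close>.
\<close>

definition deletion :: "'a \<Rightarrow> 'a \<Rightarrow> 'a \<Rightarrow> 'a \<Rightarrow> bool" where
  "deletion d p i w \<longleftrightarrow> i \<epsilon> omega \<and> (i \<epsilon> d \<and> app p i w \<or> \<not> i \<epsilon> d \<and> (\<exists>s. is_succ s i \<and> app p s w))"

definition is_del :: "'a \<Rightarrow> 'a \<Rightarrow> 'a \<Rightarrow> bool" where
  "is_del d q p \<longleftrightarrow> (\<forall>z. z \<epsilon> q \<longleftrightarrow> (\<exists>i w. is_pair z i w \<and> deletion d p i w))"

definition del :: "'a \<Rightarrow> 'a \<Rightarrow> 'a" where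
  "del d p = collect (\<lambda>z. \<exists>i w. is_pair z i w \<and> deletion d p i w)"

lemma mem_del: "z \<epsilon> del d p \<longleftrightarrow> (\<exists>i w. z = pair i w \<and> deletion d p i w)"
proof -
  have "is_set (\<lambda>z. \<exists>i w. is_pair z i w \<and> deletion d p i w)"
  proof (rule is_set_bounded)
    show "class_definable (\<lambda>e. \<exists>i w. is_pair (e 0) i w \<and> deletion d p i w)"
      unfolding deletion_def by (intro definable_class_intros)
    show "z \<epsilon> pow (pow (join omega (bigunion (bigunion p))))"
      if "\<exists>i w. is_pair z i w \<and> deletion d p i w" for z
      using that unfolding deletion_def is_pair_iff
      by (elim exE conjE, hypsubst, intro pair_mem_pow)
        (auto simp del: mem_bigunion intro: app_mem_bigunion)
  qed
  then show ?thesis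
    unfolding del_def by (simp add: mem_collect)
qed

lemma is_del_iff: "is_del d q p \<longleftrightarrow> q = del d p"
  using extensionality[of q "del d p"] by (auto simp: is_del_def mem_del)

lemma app_del: "app (del d p) i w \<longleftrightarrow> i \<epsilon> omega \<and> (if i \<epsilon> d then app p i w else app p (suc i) w)"
  by (auto simp: app_iff[of "del d p"] mem_del deletion_def)

lemma fun_on_del:
  assumes "fun_on x omega"
  shows "fun_on (del d x) omega"
    and "i \<epsilon> omega \<Longrightarrow> val (del d x) i = (if i \<epsilon> d then val x i else val x (suc i))"
proof -
  show "fun_on (del d x) omega"
  proof (rule fun_onI)
    show "\<exists>i w. i \<epsilon> omega \<and> p = pair i w" if "p \<epsilon> del d x" for p
      using that by (auto simp: mem_del deletion_def)
  qed (auto simp: app_del fun_on_app[OF assms])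
  then show "i \<epsilon> omega \<Longrightarrow> val (del d x) i = (if i \<epsilon> d then val x i else val x (suc i))"
    by (auto intro!: val_eqI simp: app_del fun_on_app[OF assms])
qed

text \<open>From index \<open>d\<close> on, the position of length \<open>n\<close> in the second
  play is the position of length \<open>suc n\<close> in the first with entry \<open>d\<close>
  removed. This lets a step of the recursion see both plays.\<close>

lemma del_res:
  assumes "d \<epsilon> omega" "n \<epsilon> omega" "\<not> n \<epsilon> d"
  shows "del d (res x (suc n)) = res (del d x) n"
proof (rule pairs_eqI)
  have "i \<epsilon> n" if "i \<epsilon> d" for i
    using nat_linear[OF assms(1,2)] nat_transitive[OF assms(2)] that assms(3) by blast
  moreover have "suc i \<epsilon> n \<or> suc i = n \<longleftrightarrow> i \<epsilon> n" for i
    using suc_mem_suc[OF assms(2), of i] by (simp del: suc_mem_suc)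
  ultimately show "app (del d (res x (suc n))) i w \<longleftrightarrow> app (res (del d x) n) i w" for i w
    by (auto simp: app_del)
qed (auto simp: mem_del mem_res)

lemma res_del_below:
  assumes "d \<epsilon> omega" "n \<epsilon> omega" "n \<epsilon> d"
  shows "res (del d x) n = res x n"
proof (rule pairs_eqI)
  have "i \<epsilon> d" "i \<epsilon> omega" if "i \<epsilon> n" for i
    using nat_transitive[OF assms(1,3) that] omega_transitive[OF assms(2) that] by auto
  then show "app (res (del d x) n) i w \<longleftrightarrow> app (res x n) i w" for i w
    by (auto simp: app_del)
qed (auto simp: mem_del mem_res)

lemma to_move_suc: "n \<epsilon> omega \<Longrightarrow> to_move P (suc n) \<longleftrightarrow> \<not> to_move P n"
  by (cases P) (simp_all add: to_move_def first_index_suc)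

lemma to_move_zero: "to_move P zero \<longleftrightarrow> P = First"
  by (cases P) (simp_all add: to_move_def first_index_zero)

text \<open>
  Strategy stealing: the replies of \<open>\<sigma>\<close> in each of the two plays are copied as the opponent's
  moves in the other one.
\<close>

lemma shifted_plays:
  assumes \<sigma>: "is_strategy omega M P \<sigma>" and d: "d \<epsilon> omega" "\<not> to_move P d"
    and v: "v \<epsilon> M" and b: "b \<epsilon> M"
  obtains x where "fun_from_to x omega M" "follows omega P \<sigma> x" "follows omega P \<sigma> (del d x)"
    "val x d = v" "d \<noteq> zero \<Longrightarrow> P = Second \<Longrightarrow> val x zero = b"
    "\<And>n. n \<epsilon> omega \<Longrightarrow> to_move P n \<Longrightarrow> val x n = val \<sigma> (res x n)"
proof -
  obtain Q where Q: "\<And>p. p \<epsilon> Q \<longleftrightarrow> (\<exists>a. a \<epsilon> omega \<and> to_move P a \<and> fun_from_to p a M)"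
    and Q_M: "fun_from_to \<sigma> Q M"
    using \<sigma> unfolding is_strategy_def by blast
  note app_\<sigma> = fun_on_app[OF fun_from_toD(1)[OF Q_M]]
  \<comment> \<open>Membership in the domain of \<open>\<sigma>\<close> tells whether it is the
    owner's turn.\<close>
  define moved where "moved p \<longleftrightarrow> (\<exists>z. app \<sigma> p z)" for p
  define copied where "copied p y \<longleftrightarrow> (\<exists>q. is_del d q p \<and> app \<sigma> q y)" for p y
  \<comment> \<open>The entry is \<open>v\<close> at \<open>d\<close>, the strategy's reply at the
    owner's turn in the first play, and otherwise its reply in the second play if it is his turn
    there. The default \<open>b\<close> is left for the opponent's entries before
    \<open>d\<close>.\<close>
  define step where "step n p y \<longleftrightarrow>
      n = d \<and> y = v \<or> \<not> n = d \<and> moved p \<and> app \<sigma> p y \<or> \<not> n = d \<and> \<not> moved p \<and> copied p y \<or>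
      \<not> n = d \<and> \<not> moved p \<and> \<not> (\<exists>z. copied p z) \<and> y = b" for n p y
  have step_iff: "step n p y \<longleftrightarrow> y = (if n = d then v else if p \<epsilon> Q then val \<sigma> p
      else if del d p \<epsilon> Q then val \<sigma> (del d p) else b)" for n p y
    by (auto simp: step_def moved_def copied_def is_del_iff app_\<sigma>)
  have "class_definable (\<lambda>e. step (e 0) (e 1) (e 2))"
    unfolding step_def moved_def copied_def is_del_def deletion_def by (intro definable_class_intros)
  then have "\<exists>x. fun_on x omega \<and> (\<forall>n. n \<epsilon> omega \<longrightarrow> step n (res x n) (val x n))"
    by (rule omega_recursion) (simp add: step_iff)
  then obtain x where x: "fun_on x omega"
    and val: "\<And>n. n \<epsilon> omega \<Longrightarrow> val x n = (if n = d then v else if res x n \<epsilon> Q then val \<sigma> (res x n)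
      else if del d (res x n) \<epsilon> Q then val \<sigma> (del d (res x n)) else b)"
    unfolding step_iff by blast
  have x_M: "fun_from_to x omega M"
    using v b fun_from_toD(2)[OF Q_M] by (intro fun_from_toI x) (simp add: val)
  have del_M: "fun_from_to (del d x) omega M"
    using fun_on_del[OF x] fun_from_toD(2)[OF x_M] by (intro fun_from_toI) auto
  \<comment> \<open>The domain of a position determines its length, so \<open>Q\<close> contains
    exactly the positions where \<open>P\<close> moves.\<close>
  have res_Q: "res y n \<epsilon> Q \<longleftrightarrow> to_move P n" if y: "fun_from_to y omega M" and n: "n \<epsilon> omega" for y n
  proof -
    have sub: "subset n omega"
      using omega_transitive n by (auto simp: subset_def)
    note f = fun_on_res[OF fun_from_toD(1)[OF y] sub]
    have "fun_from_to (res y n) n M"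
      using f fun_from_toD(2)[OF y] sub by (intro fun_from_toI) (auto simp: subset_def)
    moreover have "a = n" if "fun_from_to (res y n) a M" for a
      using fun_on_domain_unique[OF fun_from_toD(1)[OF that] f(1)] .
    ultimately show ?thesis
      unfolding Q using n by blast
  qed
  have followsI: "follows omega P \<sigma> y"
    if y: "fun_from_to y omega M" and "\<And>n. n \<epsilon> omega \<Longrightarrow> to_move P n \<Longrightarrow> val y n = val \<sigma> (res y n)" for y
    unfolding follows_def using that(2) res_Q[OF y]
    by (simp add: app_\<sigma> fun_on_app[OF fun_from_toD(1)[OF y]])
  have val_own: "val x n = val \<sigma> (res x n)" if "n \<epsilon> omega" "to_move P n" for n
    using val[OF that(1)] res_Q[OF x_M that(1)] that d by auto
  \<comment> \<open>Before \<open>d\<close> the plays coincide. Later, entry \<open>n\<close> of the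
    second play is entry \<open>suc n\<close> of the first, an opponent's move that was copied from
    the reply at this very position.\<close>
  have val_del: "val (del d x) n = val \<sigma> (res (del d x) n)" if n: "n \<epsilon> omega" "to_move P n" for n
  proof (cases "n \<epsilon> d")
    case True
    then show ?thesis
      using val_own n by (simp add: fun_on_del[OF x] res_del_below d)
  next
    case False
    have "suc n \<noteq> d"
      using False by auto
    moreover have "\<not> res x (suc n) \<epsilon> Q"
      using res_Q[OF x_M suc_mem_omega] to_move_suc n by simp
    moreover have "del d (res x (suc n)) = res (del d x) n"
      using del_res d n False by simp
    moreover have "res (del d x) n \<epsilon> Q"
      using res_Q[OF del_M] n by simp
    ultimately show ?thesis
      using val[of "suc n"] n False by (simp add: fun_on_del[OF x])
  qed
  have val_zero: "val x zero = b" if "d \<noteq> zero" "P = Second"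
  proof -
    have "\<not> res x zero \<epsilon> Q"
      using res_Q[OF x_M, of zero] that by (simp add: to_move_zero)
    moreover have "del d (res x zero) = res x zero"
      by (rule pairs_eqI) (auto simp: mem_del mem_res app_del)
    ultimately show ?thesis
      using val[of zero] that by simp
  qed
  have val_d: "val x d = v"
    using val[OF d(1)] by simp
  show thesis
    by (rule that[OF x_M followsI[OF x_M val_own] followsI[OF del_M val_del] val_d val_zero val_own])
qed

subsection \<open>The game\<close>

text \<open>Index 0 holds the set \<open>B\<close>; the increasing sequence of numbers starts at index 1.\<close>

definition legal :: "'a \<Rightarrow> 'a \<Rightarrow> bool" where
  "legal x i \<longleftrightarrow> (\<forall>j. j \<epsilon> omega \<longrightarrow> (j \<epsilon> i \<or> j = i) \<and> \<not> is_empty j \<longrightarrow>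
     (\<exists>k. k \<epsilon> omega \<and> app x j k \<and>
       (\<forall>l. l \<epsilon> j \<longrightarrow> \<not> is_empty l \<longrightarrow> (\<exists>k'. k' \<epsilon> k \<and> app x l k'))))"

definition in_result :: "'a \<Rightarrow> 'a \<Rightarrow> bool" where
  "in_result x k \<longleftrightarrow> (\<exists>i. i \<epsilon> omega \<and> \<not> is_empty i \<and> legal x i \<and> app x i k)"

definition result :: "'a \<Rightarrow> 'a" where
  "result x = collect (\<lambda>k. k \<epsilon> omega \<and> in_result x k)"

text \<open>All quantifiers are bounded, so the notion is absolute to transitive domains with
  \<open>omega\<close> as a parameter.\<close>

lemma definable_in_result:
  assumes "transitive_domain E D C" "omega \<in> C" "is_term C s" "is_term C t"
  shows "definable E D C (\<lambda>e. in_result (s e) (t e))"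
  by (rule definable_subst2[OF assms(1) _ assms(3,4)])
     (unfold in_result_def legal_def, intro definable_set_intros assms(1,2))

lemma mem_result: "k \<epsilon> result x \<longleftrightarrow> k \<epsilon> omega \<and> in_result x k"
proof -
  have "is_set (\<lambda>k. k \<epsilon> omega \<and> in_result x k)"
    by (intro is_set_sep definable_in_result transitive_domain_UNIV UNIV_I is_term_var is_term_const)
  then show ?thesis
    unfolding result_def by (simp add: mem_collect)
qed

lemma result_subset: "subset (result x) omega"
  by (simp add: subset_def mem_result)

lemma nat_le_iff: "m \<epsilon> omega \<Longrightarrow> n \<epsilon> omega \<Longrightarrow> \<not> m \<epsilon> n \<longleftrightarrow> n \<epsilon> m \<or> n = m"
  using nat_linear[of m n] not_mem_cycle[of m n] by auto

lemma legal_iff: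
  assumes x: "fun_on x omega" and i: "i \<epsilon> omega"
  shows "legal x i \<longleftrightarrow> (\<forall>j. j \<epsilon> suc i \<longrightarrow> j \<noteq> zero \<longrightarrow> val x j \<epsilon> omega \<and>
    (\<forall>l. l \<epsilon> j \<longrightarrow> l \<noteq> zero \<longrightarrow> val x l \<epsilon> val x j))"
proof -
  define K where "K j \<longleftrightarrow> (\<exists>k. k \<epsilon> omega \<and> app x j k \<and>
    (\<forall>l. l \<epsilon> j \<longrightarrow> \<not> is_empty l \<longrightarrow> (\<exists>k'. k' \<epsilon> k \<and> app x l k')))" for j
  have K: "K j \<longleftrightarrow> val x j \<epsilon> omega \<and> (\<forall>l. l \<epsilon> j \<longrightarrow> l \<noteq> zero \<longrightarrow> val x l \<epsilon> val x j)"
    if "j \<epsilon> omega" for j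
    using that omega_transitive[OF that] by (auto simp: K_def fun_on_app[OF x])
  have mem: "j \<epsilon> suc i \<longleftrightarrow> j \<epsilon> omega \<and> (j \<epsilon> i \<or> j = i)" for j
    using i omega_transitive by auto
  have "legal x i \<longleftrightarrow> (\<forall>j. j \<epsilon> suc i \<longrightarrow> j \<noteq> zero \<longrightarrow> K j)"
    unfolding legal_def K_def[symmetric] unfolding is_empty_iff mem by blast
  also have "\<dots> \<longleftrightarrow> (\<forall>j. j \<epsilon> suc i \<longrightarrow> j \<noteq> zero \<longrightarrow> val x j \<epsilon> omega \<and>
      (\<forall>l. l \<epsilon> j \<longrightarrow> l \<noteq> zero \<longrightarrow> val x l \<epsilon> val x j))"
    using K unfolding mem by simp
  finally show ?thesis .
qed

lemma legal_mono:
  assumes x: "fun_on x omega" and i: "i \<epsilon> omega" "legal x i" and j: "j \<epsilon> suc i"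
  shows "legal x j"
proof -
  have "j \<epsilon> omega"
    using i j omega_transitive by auto
  moreover have "l \<epsilon> suc i" if "l \<epsilon> suc j" for l
    using that i(1) j nat_transitive[of i j l] by auto
  ultimately show ?thesis
    using i(2) unfolding legal_iff[OF x i(1)] legal_iff[OF x \<open>j \<epsilon> omega\<close>] by blast
qed

lemma mem_result_iff:
  assumes x: "fun_on x omega"
  shows "k \<epsilon> result x \<longleftrightarrow> (\<exists>i. i \<epsilon> omega \<and> i \<noteq> zero \<and> legal x i \<and> k = val x i)"
proof -
  have "val x i \<epsilon> omega" if "i \<epsilon> omega" "i \<noteq> zero" "legal x i" for i
    using that legal_iff[OF x] by auto
  then show ?thesis
    by (auto simp: mem_result in_result_def fun_on_app[OF x])
qed

text \<open>Legality is inherited by smaller indices, so the legal indices are exactly those up to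
  \<open>n\<close>.\<close>

lemma mem_result_illegal:
  assumes x: "fun_on x omega" and n: "n \<epsilon> omega" "legal x n" "\<not> legal x (suc n)"
  shows "k \<epsilon> result x \<longleftrightarrow> (\<exists>i. i \<epsilon> suc n \<and> i \<noteq> zero \<and> k = val x i)"
proof -
  have "i \<epsilon> suc n \<longleftrightarrow> i \<epsilon> omega \<and> legal x i" for i
  proof
    show "i \<epsilon> omega \<and> legal x i" if "i \<epsilon> suc n"
      using legal_mono[OF x n(1,2) that] omega_transitive[OF suc_mem_omega[OF n(1)] that] by blast
    show "i \<epsilon> suc n" if i: "i \<epsilon> omega \<and> legal x i"
    proof (rule ccontr)
      assume "\<not> i \<epsilon> suc n"
      then have "suc n \<epsilon> suc i"
        using nat_le_iff[of i "suc n"] i n(1) by (metis mem_suc suc_mem_omega)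
      then show False
        using legal_mono[OF x] i n(3) by blast
    qed
  qed
  then show ?thesis
    unfolding mem_result_iff[OF x] by blast
qed

section \<open>Deleting one entry changes the result by one element\<close>

context
  fixes x d :: 'a
  assumes x: "fun_on x omega" and d: "d \<epsilon> omega" "d \<noteq> zero" and legal_d: "legal x (suc d)"
begin

lemma legal_del:
  assumes i: "i \<epsilon> omega" and legal: "legal x (suc i)"
  shows "legal (del d x) i"
proof -
  \<comment> \<open>\<open>?f\<close> enumerates the indices other than \<open>d\<close> in
    increasing order, and a subsequence of an increasing sequence is increasing.\<close>
  let ?f = "\<lambda>j. if j \<epsilon> d then j else suc j"
  have "val (del d x) j \<epsilon> omega \<and> (\<forall>l. l \<epsilon> j \<longrightarrow> l \<noteq> zero \<longrightarrow> val (del d x) l \<epsilon> val (del d x) j)"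
    if j: "j \<epsilon> suc i" "j \<noteq> zero" for j
  proof -
    have j_omega: "j \<epsilon> omega"
      using j i omega_transitive by auto
    have "suc j \<epsilon> suc (suc i)"
      using j i suc_mem_suc[of "suc i" j] suc_mem_omega by blast
    moreover have "j \<epsilon> suc (suc i)"
      using j by simp
    ultimately have *: "val x (?f j) \<epsilon> omega \<and> (\<forall>l. l \<epsilon> ?f j \<longrightarrow> l \<noteq> zero \<longrightarrow> val x l \<epsilon> val x (?f j))"
      using legal j(2) suc_not_zero(1)[of j] unfolding legal_iff[OF x suc_mem_omega[OF i]] by presburger
    have f: "?f l \<epsilon> ?f j \<and> ?f l \<noteq> zero \<and> l \<epsilon> omega" if "l \<epsilon> j" "l \<noteq> zero" for l
    proof -
      have "suc l \<epsilon> suc j"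
        using that suc_mem_suc[OF j_omega] by blast
      moreover have "l \<epsilon> suc j" "suc l \<noteq> zero"
        using that by simp_all
      ultimately show ?thesis
        using that omega_transitive[OF j_omega] nat_transitive[OF d(1), of j l] by presburger
    qed
    have val_del: "val (del d x) l = val x (?f l)" if "l \<epsilon> omega" for l
      by (simp add: fun_on_del(2)[OF x that])
    have "val (del d x) l \<epsilon> val (del d x) j" if "l \<epsilon> j" "l \<noteq> zero" for l
      unfolding val_del[OF j_omega] val_del[OF f[OF that, THEN conjunct2, THEN conjunct2]]
      using * f[OF that] by blast
    then show ?thesis
      using * unfolding val_del[OF j_omega] by blast
  qed
  then show ?thesis
    unfolding legal_iff[OF fun_on_del(1)[OF x] i] by blast
qed

text \<open>Indices up to \<open>suc d\<close> are covered by \<open>legal_d\<close>. Beyond them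
  only the comparison with the deleted entry is new; it goes through entry \<open>suc d\<close>,
  which survives the deletion.\<close>

lemma legal_from_del:
  assumes i: "i \<epsilon> omega" "\<not> i \<epsilon> d" and legal: "legal (del d x) i"
  shows "legal x (suc i)"
proof -
  have "val x j \<epsilon> omega \<and> (\<forall>l. l \<epsilon> j \<longrightarrow> l \<noteq> zero \<longrightarrow> val x l \<epsilon> val x j)"
    if j: "j \<epsilon> suc (suc i)" "j \<noteq> zero" for j
  proof (cases "j \<epsilon> suc (suc d)")
    case True
    then show ?thesis
      using legal_d j(2) unfolding legal_iff[OF x suc_mem_omega[OF d(1)]] by blast
  next
    case False
    have j_omega: "j \<epsilon> omega"
      using j i omega_transitive suc_mem_omega by meson
    then obtain m where m: "m \<epsilon> omega" "j = suc m"
      using j(2) omega_cases by blast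
    have "d \<epsilon> m"
      using False m d(1) nat_le_iff[of m "suc d"] suc_mem_suc[of "suc d" m] suc_mem_suc[of d m]
        nat_transitive[OF m(1), of "suc d" d] by (metis mem_suc suc_mem_omega)
    then have "\<not> m \<epsilon> d" "m \<noteq> zero"
      using not_mem_cycle by auto
    have m_i: "m \<epsilon> suc i"
      using j m i suc_mem_suc[of "suc i" m] suc_mem_omega by blast
    have val_m: "val (del d x) m = val x j"
      using \<open>\<not> m \<epsilon> d\<close> m by (simp add: fun_on_del(2)[OF x])
    have m_legal: "val x j \<epsilon> omega" "\<And>l. l \<epsilon> m \<Longrightarrow> l \<noteq> zero \<Longrightarrow> val (del d x) l \<epsilon> val x j"
      using legal m_i \<open>m \<noteq> zero\<close> unfolding legal_iff[OF fun_on_del(1)[OF x] i(1)] val_m[symmetric]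
      by blast+
    have "val x l \<epsilon> val x j" if l: "l \<epsilon> j" "l \<noteq> zero" for l
    proof -
      have l_omega: "l \<epsilon> omega"
        using l j_omega omega_transitive by blast
      consider "l \<epsilon> d" | "l = d" | "d \<epsilon> l"
        using nat_linear[OF l_omega d(1)] by blast
      then show ?thesis
      proof cases
        case 1
        then show ?thesis
          using m_legal(2)[of l] l nat_transitive[OF m(1) \<open>d \<epsilon> m\<close>] l_omega
          by (simp add: fun_on_del(2)[OF x])
      next
        case 2
        have "val x d \<epsilon> val x (suc d)"
          using legal_d d unfolding legal_iff[OF x suc_mem_omega[OF d(1)]] by simp
        moreover have "val x (suc d) \<epsilon> val x j"
          using m_legal(2)[OF \<open>d \<epsilon> m\<close> d(2)] d by (simp add: fun_on_del(2)[OF x])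
        ultimately show ?thesis
          using nat_transitive[OF m_legal(1)] 2 by blast
      next
        case 3
        obtain k where k: "k \<epsilon> omega" "l = suc k"
          using l(2) l_omega omega_cases by blast
        then have "\<not> k \<epsilon> d"
          using 3 not_mem_cycle[of k d] by auto
        moreover have "k \<epsilon> m"
          using l m k by (simp only: suc_mem_suc)
        moreover have "k \<noteq> zero"
          using 3 k d by auto
        ultimately show ?thesis
          using m_legal(2)[of k] k by (simp add: fun_on_del(2)[OF x])
      qed
    qed
    then show ?thesis
      using m_legal(1) by blast
  qed
  then show ?thesis
    unfolding legal_iff[OF x suc_mem_omega[OF i(1)]] by blast
qed

text \<open>Legality transfers both ways along the reindexing. These three facts are the premises of
  \<open>colouring_adjoin\<close>, with the deleted number as the added element.\<close>

lemma result_del: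
  "result x = adjoin (result (del d x)) (val x d)" (is ?eq)
  "\<not> val x d \<epsilon> result (del d x)" (is ?notin)
  "val x d \<epsilon> omega" (is ?nat)
proof -
  note fun_del = fun_on_del(1)[OF x] and val_del = fun_on_del(2)[OF x]
  have "legal x d"
    using legal_mono[OF x suc_mem_omega[OF d(1)] legal_d] by simp
  then have d_mem: "val x d \<epsilon> omega" and d_less: "\<And>l. l \<epsilon> d \<Longrightarrow> l \<noteq> zero \<Longrightarrow> val x l \<epsilon> val x d"
    using d unfolding legal_iff[OF x d(1)] by auto
  have below: "legal x (suc i)" "legal x i" "legal (del d x) i" if "i \<epsilon> d" for i
  proof -
    have i: "i \<epsilon> omega"
      using that d(1) omega_transitive by blast
    have "suc i \<epsilon> suc (suc d)"
      using that suc_mem_suc[OF suc_mem_omega[OF d(1)]] by simp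
    then show "legal x (suc i)"
      using legal_mono[OF x suc_mem_omega[OF d(1)] legal_d] by blast
    then show "legal (del d x) i" "legal x i"
      using legal_del[OF i] legal_mono[OF x suc_mem_omega[OF i]] by simp_all
  qed
  have "k \<epsilon> result x \<longleftrightarrow> k \<epsilon> result (del d x) \<or> k = val x d" for k
  proof
    assume "k \<epsilon> result x"
    then obtain i where i: "i \<epsilon> omega" "i \<noteq> zero" "legal x i" "k = val x i"
      unfolding mem_result_iff[OF x] by blast
    consider "i \<epsilon> d" | "i = d" | "d \<epsilon> i"
      using nat_linear[OF i(1) d(1)] by blast
    then show "k \<epsilon> result (del d x) \<or> k = val x d"
    proof cases
      case 1
      then show ?thesis
        using i below[of i] val_del[of i d] unfolding mem_result_iff[OF fun_del] by auto
    next
      case 2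
      then show ?thesis using i by simp
    next
      case 3
      obtain m where m: "m \<epsilon> omega" "i = suc m"
        using i omega_cases by blast
      then have "\<not> m \<epsilon> d" "m \<noteq> zero"
        using 3 d not_mem_cycle[of m d] by auto
      then show ?thesis
        using i m legal_del[of m] val_del[of m d] unfolding mem_result_iff[OF fun_del] by auto
    qed
  next
    assume "k \<epsilon> result (del d x) \<or> k = val x d"
    then show "k \<epsilon> result x"
    proof
      assume "k \<epsilon> result (del d x)"
      then obtain i where i: "i \<epsilon> omega" "i \<noteq> zero" "legal (del d x) i" "k = val (del d x) i"
        unfolding mem_result_iff[OF fun_del] by blast
      show ?thesis
      proof (cases "i \<epsilon> d")
        case True
        then show ?thesis
          using i below[of i] val_del[of i d] unfolding mem_result_iff[OF x] by auto
      next
        case False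
        then show ?thesis
          using i legal_from_del[of i] val_del[of i d]
          unfolding mem_result_iff[OF x] by (intro exI[of _ "suc i"]) simp
      qed
    next
      assume "k = val x d"
      then show ?thesis
        using \<open>legal x d\<close> d unfolding mem_result_iff[OF x] by blast
    qed
  qed
  then show ?eq
    by (intro extensionality) simp
  show ?notin
  proof
    assume "val x d \<epsilon> result (del d x)"
    then obtain i where i: "i \<epsilon> omega" "i \<noteq> zero" "legal (del d x) i" "val x d = val (del d x) i"
      unfolding mem_result_iff[OF fun_del] by blast
    show False
    proof (cases "i \<epsilon> d")
      case True
      then show ?thesis
        using d_less[of i] i val_del[of i d] by simp
    next
      case False
      \<comment> \<open>The entry in question is \<open>val x (suc i)\<close>, which is strictly
        above \<open>val x d\<close>.\<close>
      then have "d \<epsilon> suc i"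
        using nat_le_iff[OF i(1) d(1)] by auto
      then have "val x d \<epsilon> val x (suc i)"
        using legal_from_del[OF i(1) False i(3)] d(2) suc_not_zero(1)[of i] mem_suc[of "suc i" "suc i"]
        unfolding legal_iff[OF x suc_mem_omega[OF i(1)]] by blast
      then show ?thesis
        using False i val_del[of i d] by simp
    qed
  qed
  show ?nat
    by (fact d_mem)
qed

end

section \<open>The payoff set and its relativised definition\<close>

abbreviation reals :: 'a where "reals \<equiv> pow omega"
abbreviation moves :: 'a where "moves \<equiv> pow reals"

lemma mem_moves: "z \<epsilon> moves \<longleftrightarrow> (\<forall>w. w \<epsilon> z \<longrightarrow> subset w omega)"
  by (simp add: subset_def)

text \<open>By transitivity of \<open>omega\<close> the elements of a natural number are themselves
  sets of numbers, so numbers are moves without any coding.\<close>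

lemma nat_mem_moves: "n \<epsilon> omega \<Longrightarrow> n \<epsilon> moves"
  unfolding mem_moves unfolding subset_def using omega_transitive by blast

text \<open>
  Versions relativised to \<open>D\<close>, for use in a formula interpreted in a level of the hierarchy.
\<close>

definition colouring_in :: "'a set \<Rightarrow> 'a \<Rightarrow> bool" where
  "colouring_in D B \<longleftrightarrow> zero \<epsilon> B \<and> (\<forall>r\<in>D. \<forall>s\<in>D. \<forall>m. m \<epsilon> omega \<longrightarrow>
     subset r omega \<and> \<not> m \<epsilon> r \<and> is_adjoin s r m \<longrightarrow> (r \<epsilon> B \<longleftrightarrow> \<not> s \<epsilon> B))"

definition payoff_in :: "'a set \<Rightarrow> 'a \<Rightarrow> bool" where
  "payoff_in D x \<longleftrightarrow> (\<exists>B\<in>D. app x zero B \<and> colouring_in D B \<and>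
     (\<exists>r\<in>D. (\<forall>k. k \<epsilon> r \<longrightarrow> k \<epsilon> omega \<and> in_result x k) \<and>
       (\<forall>k. k \<epsilon> omega \<longrightarrow> in_result x k \<longrightarrow> k \<epsilon> r) \<and> r \<epsilon> B))"

definition payoff :: "'a \<Rightarrow> bool" where
  "payoff x \<longleftrightarrow> (\<exists>B. app x zero B \<and> colouring B \<and> result x \<epsilon> B)"

lemma definable_payoff_in:
  assumes "transitive_domain E D C" "omega \<in> C" "zero \<in> C" "is_term C s"
  shows "definable E D C (\<lambda>e. payoff_in D (s e))"
  by (rule definable_subst1[OF assms(1) _ assms(4)])
     (unfold payoff_in_def colouring_in_def,
      intro definable_set_intros definable_in_result definable_is_adjoin assms(1-3))

text \<open>Only reals matter for the condition, and adjoining a number to a real gives a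
  real.\<close>

lemma colouring_in_iff:
  assumes "\<And>r. subset r omega \<Longrightarrow> r \<in> D"
  shows "colouring_in D B \<longleftrightarrow> colouring B"
proof -
  have "subset (adjoin r m) omega" if "subset r omega" "m \<epsilon> omega" for r m
    using that by (auto simp: subset_def)
  then show ?thesis
    unfolding colouring_in_def colouring_def is_adjoin_iff using assms by metis
qed

text \<open>The witness \<open>r\<close> is forced to be \<open>result x\<close>, a real, and
  \<open>B\<close> is an entry of \<open>x\<close>; the two hypotheses place both in
  \<open>D\<close>.\<close>

lemma payoff_in_iff:
  assumes D: "\<And>r. subset r omega \<Longrightarrow> r \<in> D" and x: "\<And>B. app x zero B \<Longrightarrow> B \<in> D"
  shows "payoff_in D x \<longleftrightarrow> payoff x"
proof -
  have result: "(\<forall>k. k \<epsilon> r \<longrightarrow> k \<epsilon> omega \<and> in_result x k) \<and>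
      (\<forall>k. k \<epsilon> omega \<longrightarrow> in_result x k \<longrightarrow> k \<epsilon> r) \<longleftrightarrow> r = result x" for r
    using extensionality[of r "result x"] by (auto simp: mem_result)
  have "result x \<in> D"
    using D result_subset by blast
  then have "(\<exists>r\<in>D. (\<forall>k. k \<epsilon> r \<longrightarrow> k \<epsilon> omega \<and> in_result x k) \<and>
      (\<forall>k. k \<epsilon> omega \<longrightarrow> in_result x k \<longrightarrow> k \<epsilon> r) \<and> r \<epsilon> B) \<longleftrightarrow> result x \<epsilon> B" for B
    unfolding conj_assoc[symmetric] result by blast
  moreover have "colouring_in D B \<longleftrightarrow> colouring B" for B
    by (rule colouring_in_iff) (rule D)
  ultimately show ?thesis
    unfolding payoff_in_def payoff_def using x by auto
qed

definition payoff_set :: 'a where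
  "payoff_set = collect (\<lambda>x. fun_from_to x omega moves \<and> payoff x)"

lemma mem_payoff_set: "x \<epsilon> payoff_set \<longleftrightarrow> fun_from_to x omega moves \<and> payoff x"
proof -
  \<comment> \<open>The relativised version avoids the function \<open>result\<close> and so
    supplies a formula over the universe too.\<close>
  have "payoff x \<longleftrightarrow> payoff_in UNIV x" for x
    by (rule payoff_in_iff[symmetric]) auto
  then have "class_definable (\<lambda>e. fun_from_to (e 0) omega moves \<and> payoff (e 0))"
    unfolding fun_from_to_def
    by (simp only:) (intro definable_class_intros definable_payoff_in)
  moreover have "x \<epsilon> pow (pow (pow (join omega moves)))" if "fun_from_to x omega moves" for x
  proof -
    have "p \<epsilon> pow (pow (join omega moves))" if p: "p \<epsilon> x" for p
    proof -
      obtain i where "i \<epsilon> omega" "p = pair i (val x i)"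
        using p fun_on_mem[OF fun_from_toD(1)[OF \<open>fun_from_to x omega moves\<close>]] by blast
      then show ?thesis
        using fun_from_toD(2)[OF \<open>fun_from_to x omega moves\<close>, of i]
        by (metis pair_mem_pow[of i "join omega moves" "val x i"] mem_join)
    qed
    then show ?thesis
      unfolding mem_pow[of x] unfolding subset_def[of x] by blast
  qed
  ultimately have "is_set (\<lambda>x. fun_from_to x omega moves \<and> payoff x)"
    by (intro is_set_bounded) blast+
  then show ?thesis
    unfolding payoff_set_def by (simp add: mem_collect)
qed

lemma payoff_iff:
  assumes "fun_on x omega"
  shows "payoff x \<longleftrightarrow> colouring (val x zero) \<and> result x \<epsilon> val x zero"
  by (auto simp: payoff_def fun_on_app[OF assms])

text \<open>The source of all contradictions: two plays that start with the same colouring and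
  differ by such a deletion have different winners.\<close>

lemma colouring_result_del:
  assumes "fun_on x omega" "d \<epsilon> omega" "d \<noteq> zero" "legal x (suc d)" "colouring B"
  shows "result x \<epsilon> B \<longleftrightarrow> \<not> result (del d x) \<epsilon> B"
  using colouring_adjoin[OF assms(5) result_subset result_del(3,2)[OF assms(1-4)]]
    result_del(1)[OF assms(1-4)] by simp

section \<open>Neither player has a winning strategy\<close>

lemma no_winning_strategy_First: "\<not> winning_strategy omega moves payoff_set First \<sigma>"
proof
  let ?one = "suc zero"
  assume win: "winning_strategy omega moves payoff_set First \<sigma>"
  then have strat: "is_strategy omega moves First \<sigma>"
    by (simp add: winning_strategy_def)
  have one: "?one \<epsilon> omega" "\<not> to_move First ?one"
    by (simp_all add: to_move_suc to_move_zero)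
  \<comment> \<open>Index 1 is the second player's first move; he names 0 in the first play.\<close>
  obtain x where x: "fun_from_to x omega moves" "follows omega First \<sigma> x"
      "follows omega First \<sigma> (del ?one x)" "val x ?one = zero"
    using shifted_plays[OF strat one nat_mem_moves[OF zero_mem_omega] nat_mem_moves[OF zero_mem_omega]]
    by blast
  note fun_x = fun_from_toD(1)[OF x(1)]
  note fun_del = fun_on_del(1)[OF fun_x, of ?one] and val_del = fun_on_del(2)[OF fun_x, of _ ?one]
  have "fun_from_to (del ?one x) omega moves"
    by (intro fun_from_toI fun_del) (simp only: val_del fun_from_toD(2)[OF x(1)] suc_mem_omega split: if_split, simp)
  then have "payoff x" "payoff (del ?one x)"
    using win x unfolding winning_strategy_def wins_def by (simp_all add: mem_payoff_set)
  moreover have "val (del ?one x) zero = val x zero"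
    by (simp add: val_del)
  ultimately have col: "colouring (val x zero)" and res: "result x \<epsilon> val x zero"
    "result (del ?one x) \<epsilon> val x zero"
    by (simp_all add: payoff_iff fun_x fun_del)
  have "legal x ?one"
    by (auto simp: legal_iff[OF fun_x] x(4))
  \<comment> \<open>If index 2 were legal too, the first player could not win both plays.\<close>
  have illegal: "\<not> legal x (suc ?one)"
    using colouring_result_del[OF fun_x one(1) _ _ col] res by auto
  have "(\<exists>i. i \<epsilon> suc ?one \<and> i \<noteq> zero \<and> k = val x i) \<longleftrightarrow> k = val x ?one" for k
    by (metis mem_suc mem_zero suc_not_zero(1))
  then have "k \<epsilon> result x \<longleftrightarrow> k = val x ?one" for k
    unfolding mem_result_illegal[OF fun_x one(1) \<open>legal x ?one\<close> illegal] .
  then have "k \<epsilon> result x \<longleftrightarrow> k \<epsilon> adjoin zero zero" for k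
    by (simp add: x(4))
  \<comment> \<open>Only 0 was named, and one change from the empty set leaves the colouring, so the
    first player has lost.\<close>
  then have "result x = adjoin zero zero"
    by (intro extensionality) blast
  then show False
    using res(1) colouring_adjoin[OF col, of zero zero] colouring_zero[OF col] by (simp add: subset_def)
qed

lemma no_winning_strategy_Second: "\<not> winning_strategy omega moves payoff_set Second \<sigma>"
proof
  let ?one = "suc zero" and ?two = "suc (suc zero)"
  assume win: "winning_strategy omega moves payoff_set Second \<sigma>"
  then have strat: "is_strategy omega moves Second \<sigma>"
    by (simp add: winning_strategy_def)
  have two: "?two \<epsilon> omega" "\<not> to_move Second ?two" and one: "?one \<epsilon> omega" "to_move Second ?one"
    by (simp_all add: to_move_suc to_move_zero)
  obtain B where B: "subset B reals" and col: "colouring B"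
    using ex_colouring by blast
  \<comment> \<open>The strategy's reply to the opening \<open>B\<close>, computed from the one-move
    position, because \<open>v\<close> depends on it.\<close>
  define a where "a = val \<sigma> (upair (pair zero B) (pair zero B))"
  \<comment> \<open>The next number after \<open>a\<close> keeps the play legal at index 2, the
    first player's first move after the opening. If \<open>a\<close> is not a number, a violation
    has already occurred and 0 is a mere filler.\<close>
  define v where "v = (if a \<epsilon> omega then suc a else zero)"
  have "v \<epsilon> moves"
    unfolding v_def by (auto intro!: nat_mem_moves simp del: mem_pow)
  then obtain x where x: "fun_from_to x omega moves" "follows omega Second \<sigma> x"
      "follows omega Second \<sigma> (del ?two x)" "val x ?two = v" "val x zero = B"
      "val x ?one = val \<sigma> (res x ?one)"
    using shifted_plays[OF strat two, of v B] B one by (metis mem_pow suc_not_zero(1))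
  note fun_x = fun_from_toD(1)[OF x(1)]
  note fun_del = fun_on_del(1)[OF fun_x, of ?two] and val_del = fun_on_del(2)[OF fun_x, of _ ?two]
  have "res x ?one = upair (pair zero B) (pair zero B)"
    by (rule extensionality) (use x(5) in \<open>auto simp: mem_res fun_on_mem[OF fun_x]\<close>)
  then have val_one: "val x ?one = a"
    using x(6) by (simp add: a_def)
  have "fun_from_to (del ?two x) omega moves"
    by (intro fun_from_toI fun_del) (simp only: val_del fun_from_toD(2)[OF x(1)] suc_mem_omega split: if_split, simp)
  then have "\<not> payoff x" "\<not> payoff (del ?two x)"
    using win x unfolding winning_strategy_def wins_def by (simp_all add: mem_payoff_set)
  moreover have "val (del ?two x) zero = B"
    by (simp add: val_del x(5))
  ultimately have res: "\<not> result x \<epsilon> B" "\<not> result (del ?two x) \<epsilon> B"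
    using col by (simp_all add: payoff_iff fun_x fun_del x(5))
  \<comment> \<open>Otherwise nothing is named legally, and the empty result lies in
    \<open>B\<close>.\<close>
  have "a \<epsilon> omega"
  proof (rule ccontr)
    assume "\<not> a \<epsilon> omega"
    then have "\<not> legal x ?one"
      by (auto simp: legal_iff[OF fun_x] val_one)
    moreover have "legal x zero"
      by (auto simp: legal_iff[OF fun_x])
    ultimately have "\<not> k \<epsilon> result x" for k
      using mem_result_illegal[OF fun_x zero_mem_omega] by auto
    then have "result x = zero"
      by (intro extensionality) simp
    then show False
      using res(1) colouring_zero[OF col] by simp
  qed
  then have v: "v = suc a"
    by (simp add: v_def)
  have "legal x ?two"
    using \<open>a \<epsilon> omega\<close> by (auto simp: legal_iff[OF fun_x] val_one x(4) v)
  \<comment> \<open>If index 3 were legal too, the second player could not win both plays.\<close>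
  have illegal: "\<not> legal x (suc ?two)"
    using colouring_result_del[OF fun_x two(1) _ _ col] res by auto
  have "(\<exists>i. i \<epsilon> suc ?two \<and> i \<noteq> zero \<and> k = val x i) \<longleftrightarrow> k = val x ?one \<or> k = val x ?two" for k
    by (metis mem_suc mem_zero suc_not_zero(1))
  then have "k \<epsilon> result x \<longleftrightarrow> k = val x ?one \<or> k = val x ?two" for k
    unfolding mem_result_illegal[OF fun_x two(1) \<open>legal x ?two\<close> illegal] .
  then have "k \<epsilon> result x \<longleftrightarrow> k \<epsilon> adjoin (adjoin zero a) (suc a)" for k
    by (simp add: val_one x(4) v)
  then have "result x = adjoin (adjoin zero a) (suc a)"
    by (intro extensionality) blast
  \<comment> \<open>Exactly two numbers were named; two changes from the empty set lead back into
    \<open>B\<close>, so the second player has lost.\<close>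
  moreover have "suc a \<noteq> a"
    by (metis mem_suc not_mem_self)
  then have "adjoin (adjoin zero a) (suc a) \<epsilon> B \<longleftrightarrow> \<not> adjoin zero a \<epsilon> B"
    using \<open>a \<epsilon> omega\<close> by (intro colouring_adjoin[OF col]) (auto simp: subset_def)
  moreover have "adjoin zero a \<epsilon> B \<longleftrightarrow> \<not> zero \<epsilon> B"
    using \<open>a \<epsilon> omega\<close> by (intro colouring_adjoin[OF col]) (auto simp: subset_def)
  ultimately show False
    using res(1) colouring_zero[OF col] by simp
qed

lemma undetermined: "\<not> determined omega moves payoff_set"
  unfolding determined_def using no_winning_strategy_First no_winning_strategy_Second
  by (metis player.exhaust)

section \<open>Ordinal definability of the payoff set\<close>

lemma ordinal_definable_payoff_set: "ordinal_definable payoff_set"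
proof -
  obtain v0 where v0: "is_V v0 omega" "transitive_set v0" "subset omega v0"
    using ex_V_omega by blast
  \<comment> \<open>The suffix counts power sets above level \<omega>: reals lie in
    \<open>?v1\<close>, moves and numbers in \<open>?v2\<close>, pairs of a number and a move in
    \<open>?v4\<close>, plays in \<open>?v5\<close>, and the payoff set in
    \<open>?v\<close>.\<close>
  let ?v1 = "pow v0"
  let ?v2 = "pow ?v1" let ?v4 = "pow (pow ?v2)" let ?v5 = "pow ?v4" let ?v = "pow ?v5"
  have V: "is_V ?v (suc (suc (suc (suc (suc (suc omega))))))"
    by (intro is_V_suc v0)
  have t1: "transitive_set ?v1" and t2: "transitive_set ?v2" and t4: "transitive_set ?v4"
    and t5: "transitive_set ?v5" and t: "transitive_set ?v"
    by (intro transitive_set_pow v0)+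
  have up: "z \<epsilon> ?v2" if "z \<epsilon> ?v1" for z
    using transitive_set_pow(2)[OF t1] that unfolding subset_def[of ?v1] by blast
  have up': "z \<epsilon> ?v" if "z \<epsilon> ?v2" for z
    using transitive_set_pow(2)[OF t5] transitive_set_pow(2)[OF t4]
      transitive_set_pow(2)[OF transitive_set_pow(1)[OF t2]] transitive_set_pow(2)[OF t2] that
    unfolding subset_def[of "pow _"] by blast
  have reals_v1: "r \<epsilon> ?v1" if "subset r omega" for r
    using that v0(3) by (simp add: subset_def)
  have moves_v2: "m \<epsilon> ?v2" if "m \<epsilon> moves" for m
    using that[unfolded mem_moves] reals_v1 unfolding mem_pow[of m] subset_def[of m] by blast
  have omega_v2: "n \<epsilon> ?v2" if "n \<epsilon> omega" for n
    using moves_v2 nat_mem_moves that by blast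
  have plays_v5: "x \<epsilon> ?v5" if x: "fun_from_to x omega moves" for x
  proof -
    have "p \<epsilon> ?v4" if p: "p \<epsilon> x" for p
    proof -
      obtain i where "i \<epsilon> omega" "p = pair i (val x i)"
        using p fun_on_mem[OF fun_from_toD(1)[OF x]] by blast
      then show ?thesis
        using fun_from_toD(2)[OF x] pair_mem_pow omega_v2 moves_v2 by metis
    qed
    then show ?thesis
      unfolding mem_pow[of x] subset_def[of x] by blast
  qed
  have A_v: "payoff_set \<epsilon> ?v"
    unfolding mem_pow[of payoff_set] subset_def[of payoff_set] using plays_v5 mem_payoff_set by blast
  define D where "D = {z. z \<epsilon> ?v}"
  \<comment> \<open>The permitted parameters.\<close>
  define C where "C = {c. ordinal c \<and> c \<epsilon> ?v}"
  have D_closed: "y \<in> D" if "x \<in> D" "y \<epsilon> x" for x y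
    using t that unfolding transitive_set_def subset_def[of _ ?v] D_def by blast
  then have dom: "transitive_domain E D C"
    unfolding transitive_domain_def by (auto simp: C_def D_def)
  have reals_D: "r \<in> D" if "subset r omega" for r
    unfolding D_def using up' up reals_v1 that by blast
  have "omega \<in> C" "zero \<in> C"
    using ordinal_omega ordinal_nat[OF zero_mem_omega] reals_D[of omega] reals_D[of zero]
    unfolding C_def D_def subset_def by simp_all
  \<comment> \<open>Membership in \<open>moves\<close> is spelled out by elements, since
    \<open>moves\<close> is not an ordinal and cannot serve as a parameter.\<close>
  define is_payoff_set where "is_payoff_set X \<longleftrightarrow> (\<forall>y\<in>D. y \<epsilon> X \<longleftrightarrow>
      (fun_on y omega \<and> (\<forall>i. i \<epsilon> omega \<longrightarrow> (\<forall>z\<in>D. app y i z \<longrightarrow> (\<forall>w. w \<epsilon> z \<longrightarrow> subset w omega)))) \<and>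
      payoff_in D y)" for X
  have "definable E D C (\<lambda>e. is_payoff_set (e 0))"
    unfolding is_payoff_set_def
    by (intro definable_set_intros definable_payoff_in dom \<open>omega \<in> C\<close> \<open>zero \<in> C\<close>)
  from definable_single[OF this \<open>omega \<in> C\<close>] obtain \<phi> e where e: "\<And>i. e i \<in> C"
    and sat: "\<And>x. x \<in> D \<Longrightarrow> is_payoff_set x \<longleftrightarrow> sat E D \<phi> (case_nat x e)"
    using dom unfolding transitive_domain_def by metis
  have is_payoff_set: "is_payoff_set X \<longleftrightarrow> X = payoff_set" if "X \<in> D" for X
  proof -
    \<comment> \<open>Components of a pair in \<open>D\<close> are found in \<open>D\<close> by
      going down two members.\<close>
    have app_D: "z \<in> D" if "y \<in> D" "app y i z" for y i z
    proof -
      have "pair i z \<in> D"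
        using that D_closed by (auto simp: app_iff)
      then have "upair i z \<in> D"
        by (rule D_closed) (simp add: pair_def)
      then show ?thesis
        by (rule D_closed) simp
    qed
    have "(fun_on y omega \<and> (\<forall>i. i \<epsilon> omega \<longrightarrow> (\<forall>z\<in>D. app y i z \<longrightarrow> (\<forall>w. w \<epsilon> z \<longrightarrow> subset w omega)))) \<longleftrightarrow>
        fun_from_to y omega moves" if "y \<in> D" for y
      unfolding fun_from_to_def mem_moves using app_D[OF that] fun_on_app by metis
    moreover have "payoff_in D y \<longleftrightarrow> payoff y" if "y \<in> D" for y
      by (rule payoff_in_iff) (use reals_D app_D that in auto)
    ultimately have "is_payoff_set X \<longleftrightarrow> (\<forall>y\<in>D. y \<epsilon> X \<longleftrightarrow> y \<epsilon> payoff_set)"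
      unfolding is_payoff_set_def mem_payoff_set by simp
    \<comment> \<open>Both sets lie in \<open>D\<close>, and so do all their elements; agreement on
      \<open>D\<close> is therefore equality.\<close>
    also have "\<dots> \<longleftrightarrow> X = payoff_set"
    proof
      assume "\<forall>y\<in>D. y \<epsilon> X \<longleftrightarrow> y \<epsilon> payoff_set"
      moreover have "payoff_set \<in> D"
        using A_v by (simp add: D_def)
      ultimately show "X = payoff_set"
        using D_closed \<open>X \<in> D\<close> by (intro extensionality) blast
    qed simp
    finally show ?thesis .
  qed
  show ?thesis
    unfolding ordinal_definable_def
  proof (intro exI conjI)
    show "is_V ?v (suc (suc (suc (suc (suc (suc omega))))))"
      by (fact V)
    show "payoff_set \<epsilon> ?v"
      by (fact A_v)
    show "\<forall>i. ordinal (e i) \<and> e i \<epsilon> ?v"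
      using e by (simp add: C_def)
    show "\<forall>x. x \<epsilon> ?v \<longrightarrow> (sat E {z. z \<epsilon> ?v} \<phi> (case_nat x e) \<longleftrightarrow> x = payoff_set)"
      using sat is_payoff_set unfolding D_def by blast
  qed
qed

end

theorem theorem2:
  fixes E :: "'v \<Rightarrow> 'v \<Rightarrow> bool"
  assumes "zfc E"
  shows "\<exists>\<omega> R M A.
    membership.is_omega E \<omega> \<and> membership.is_power E R \<omega> \<and> membership.is_power E M R \<and>
    membership.is_game E \<omega> M A \<and>
    \<not> membership.determined E \<omega> M A \<and>
    membership.ordinal_definable E A"
proof -
  interpret zfc E by fact
  have "is_game omega moves payoff_set"
    unfolding is_game_def using ordinal_omega nat_mem_moves[OF zero_mem_omega] mem_payoff_set
    by (auto simp: is_empty_def simp del: is_empty_iff)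
  then show ?thesis
    using is_omega_omega undetermined ordinal_definable_payoff_set
    by (intro exI[of _ omega] exI[of _ reals] exI[of _ moves] exI[of _ payoff_set]) simp
qed

end
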